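(* Let $H$ be a Hopf algebra over $k$. Suppose the subgroup $\langle W\rangle$ of $G(H)$ is abelian and torsionfree. If $\operatorname{rank}\langle\Gamma\rangle>\operatorname{rank}\langle W\rangle=1$, then $H$ has exponential growth.
   Context: $k$ is an algebraically closed field of characteristic zero and everything is over $k$. $G(H)$ is the group of group-like elements of $H$ and $C_0=kG(H)$ is its linear span. A nonzero element $y\in H$ is called skew primitive (always meaning $(1,g)$-primitive) if $\Delta(y)=y\otimes 1+g\otimes y$ for some $g$; then $g$ is group-like and uniquely determined, is called the weight of $y$, and is denoted $\mu(y)$. $W$ is the set of weights $\mu(y)$ of all skew primitive $y\notin C_0$, and $\langle W\rangle$ is the subgroup of $G(H)$ it generates. For a skew primitive $y\notin C_0$, if there is $c\in k^\times$ with $\mu(y)^{-1}y\mu(y)-cy\in C_0$, then $c$ (which is unique) is called the commutator of $y$ and denoted $\gamma(y)$. $\Gamma\subset k^\times$ is the set of all $\gamma(y)$ for skew primitive $y\notin C_0$ such that $\gamma(y)$ exists, and $\langle\Gamma\rangle$ is the subgroup of $k^\times$ it generates. $\operatorname{rank}$ denotes the torsionfree rank of an abelian group. An algebra has exponential growth if it contains a finite dimensional subspace $V\ni 1$ with $\limsup_n(\dim V^n)^{1/n}>1$, where $V^n$ is the span of products of $n$ elements of $V$. *)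

theory Defs
  imports
    "HOL-Library.Poly_Mapping"
    "HOL-Library.Extended_Nat"
    "HOL-Library.Extended_Real"
    "HOL-Library.Liminf_Limsup"
    "HOL-Computational_Algebra.Polynomial"
    "HOL-Algebra.Generated_Groups"
    "HOL-Algebra.FiniteProduct"
begin

section \<open>Tensor powers of a vector space\<close>

text \<open>
  \<open>V \<otimes> V\<close> is the free vector space on \<open>V \<times> V\<close> (the finitely supported functions) modulo
  the bilinearity relations; its elements are cosets. \<open>V \<otimes> V \<otimes> V\<close> is obtained from
  \<open>V \<times> V \<times> V\<close> in the same way.
\<close>

definition free_scale :: "'k::field \<Rightarrow> ('x \<Rightarrow>\<^sub>0 'k) \<Rightarrow> ('x \<Rightarrow>\<^sub>0 'k)" where
  "free_scale c f = Poly_Mapping.map ((*) c) f"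

lemma lookup_free_scale: "Poly_Mapping.lookup (free_scale c f) x = c * Poly_Mapping.lookup f x"
  by (simp add: free_scale_def Poly_Mapping.map.rep_eq when_def)

lemma vector_space_free_scale: "vector_space free_scale"
  by standard (auto intro!: poly_mapping_eqI
      simp: lookup_free_scale lookup_add algebra_simps)

definition lin_ext :: "('k::field \<Rightarrow> 'v::ab_group_add \<Rightarrow> 'v) \<Rightarrow> ('x \<Rightarrow> 'v) \<Rightarrow> ('x \<Rightarrow>\<^sub>0 'k) \<Rightarrow> 'v" where
  "lin_ext scale \<phi> f = (\<Sum>x\<in>Poly_Mapping.keys f. scale (Poly_Mapping.lookup f x) (\<phi> x))"

abbreviation gen :: "'x \<Rightarrow> ('x \<Rightarrow>\<^sub>0 'k::field)" where
  "gen x \<equiv> Poly_Mapping.single x 1"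

definition bilinear_rels :: "('k::field \<Rightarrow> 'h::ab_group_add \<Rightarrow> 'h) \<Rightarrow> ('h \<times> 'h \<Rightarrow>\<^sub>0 'k) set" where
  "bilinear_rels scale = module.span free_scale
     ({gen (a + a', b) - (gen (a, b) + gen (a', b)) | a a' b. True} \<union>
      {gen (a, b + b') - (gen (a, b) + gen (a, b')) | a b b'. True} \<union>
      {gen (scale c a, b) - free_scale c (gen (a, b)) | c a b. True} \<union>
      {gen (a, scale c b) - free_scale c (gen (a, b)) | c a b. True})"

definition trilinear_rels :: "('k::field \<Rightarrow> 'h::ab_group_add \<Rightarrow> 'h) \<Rightarrow> ('h \<times> 'h \<times> 'h \<Rightarrow>\<^sub>0 'k) set" where
  "trilinear_rels scale = module.span free_scale
     ({gen (a + a', b, d) - (gen (a, b, d) + gen (a', b, d)) | a a' b d. True} \<union>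
      {gen (a, b + b', d) - (gen (a, b, d) + gen (a, b', d)) | a b b' d. True} \<union>
      {gen (a, b, d + d') - (gen (a, b, d) + gen (a, b, d')) | a b d d'. True} \<union>
      {gen (scale c a, b, d) - free_scale c (gen (a, b, d)) | c a b d. True} \<union>
      {gen (a, scale c b, d) - free_scale c (gen (a, b, d)) | c a b d. True} \<union>
      {gen (a, b, scale c d) - free_scale c (gen (a, b, d)) | c a b d. True})"

definition tensor2 ::
  "('k::field \<Rightarrow> 'h::ab_group_add \<Rightarrow> 'h) \<Rightarrow> ('h \<times> 'h \<Rightarrow>\<^sub>0 'k) \<Rightarrow> ('h \<times> 'h \<Rightarrow>\<^sub>0 'k) set" where
  "tensor2 scale f = {g. g - f \<in> bilinear_rels scale}"

definition tensor3 ::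
  "('k::field \<Rightarrow> 'h::ab_group_add \<Rightarrow> 'h) \<Rightarrow> ('h \<times> 'h \<times> 'h \<Rightarrow>\<^sub>0 'k) \<Rightarrow> ('h \<times> 'h \<times> 'h \<Rightarrow>\<^sub>0 'k) set" where
  "tensor3 scale f = {g. g - f \<in> trilinear_rels scale}"

text \<open>The multiplication \<open>(a \<otimes> b)(a' \<otimes> b') = aa' \<otimes> bb'\<close>, on representatives.\<close>

definition tensor_mult ::
  "('h::ring_1 \<times> 'h \<Rightarrow>\<^sub>0 'k::field) \<Rightarrow> ('h \<times> 'h \<Rightarrow>\<^sub>0 'k) \<Rightarrow> ('h \<times> 'h \<Rightarrow>\<^sub>0 'k)" where
  "tensor_mult f g =
     lin_ext free_scale (\<lambda>(a, b). lin_ext free_scale (\<lambda>(a', b'). gen (a * a', b * b')) g) f"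

section \<open>Hopf algebras\<close>

text \<open>
  The comultiplication \<open>\<Delta>\<close> maps into the cosets that make up \<open>H \<otimes> H\<close>. Each axiom involving
  \<open>\<Delta>\<close> is imposed on all representatives \<open>f \<in> \<Delta> x\<close>, which is the same as imposing it on
  cosets, because all the maps involved respect the (multi)linearity relations. In
  \<open>comul_coassoc\<close>, \<open>D\<close> is any choice of representatives of \<open>\<Delta>\<close>, and the two sides are
  \<open>(\<Delta> \<otimes> id) (\<Delta> x)\<close> and \<open>(id \<otimes> \<Delta>) (\<Delta> x)\<close>.
\<close>

locale hopf_algebra = vector_space scale
  for scale :: "'k::field \<Rightarrow> 'h::ring_1 \<Rightarrow> 'h" +
  fixes \<Delta> :: "'h \<Rightarrow> ('h \<times> 'h \<Rightarrow>\<^sub>0 'k) set"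
    and \<epsilon> :: "'h \<Rightarrow> 'k"
    and S :: "'h \<Rightarrow> 'h"
  assumes scale_mult_left: "scale c x * y = scale c (x * y)"
    and scale_mult_right: "x * scale c y = scale c (x * y)"
    and comul_tensor: "\<Delta> x \<in> range (tensor2 scale)"
    and comul_add: "f \<in> \<Delta> x \<Longrightarrow> g \<in> \<Delta> y \<Longrightarrow> f + g \<in> \<Delta> (x + y)"
    and comul_scale: "f \<in> \<Delta> x \<Longrightarrow> free_scale c f \<in> \<Delta> (scale c x)"
    and comul_mult: "f \<in> \<Delta> x \<Longrightarrow> g \<in> \<Delta> y \<Longrightarrow> tensor_mult f g \<in> \<Delta> (x * y)"
    and comul_one: "\<Delta> 1 = tensor2 scale (gen (1, 1))"
    and comul_coassoc: "f \<in> \<Delta> x \<Longrightarrow> (\<And>a. D a \<in> \<Delta> a) \<Longrightarrow>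
      tensor3 scale
        (lin_ext free_scale (\<lambda>(a, b). lin_ext free_scale (\<lambda>(u, v). gen (u, v, b)) (D a)) f) =
      tensor3 scale
        (lin_ext free_scale (\<lambda>(a, b). lin_ext free_scale (\<lambda>(u, v). gen (a, u, v)) (D b)) f)"
    and counit_linear: "Vector_Spaces.linear scale (*) \<epsilon>"
    and counit_mult: "\<epsilon> (x * y) = \<epsilon> x * \<epsilon> y"
    and counit_one: "\<epsilon> 1 = 1"
    and counit_left: "f \<in> \<Delta> x \<Longrightarrow> lin_ext scale (\<lambda>(a, b). scale (\<epsilon> a) b) f = x"
    and counit_right: "f \<in> \<Delta> x \<Longrightarrow> lin_ext scale (\<lambda>(a, b). scale (\<epsilon> b) a) f = x"
    and antipode_linear: "Vector_Spaces.linear scale scale S"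
    and antipode_left: "f \<in> \<Delta> x \<Longrightarrow> lin_ext scale (\<lambda>(a, b). S a * b) f = scale (\<epsilon> x) 1"
    and antipode_right: "f \<in> \<Delta> x \<Longrightarrow> lin_ext scale (\<lambda>(a, b). a * S b) f = scale (\<epsilon> x) 1"

section \<open>Group-like and skew primitive elements\<close>

definition group_likes ::
  "('k::field \<Rightarrow> 'h::ring_1 \<Rightarrow> 'h) \<Rightarrow> ('h \<Rightarrow> ('h \<times> 'h \<Rightarrow>\<^sub>0 'k) set) \<Rightarrow> 'h set" where
  "group_likes scale \<Delta> = {g. g \<noteq> 0 \<and> \<Delta> g = tensor2 scale (gen (g, g))}"

definition group_like_group ::
  "('k::field \<Rightarrow> 'h::ring_1 \<Rightarrow> 'h) \<Rightarrow> ('h \<Rightarrow> ('h \<times> 'h \<Rightarrow>\<^sub>0 'k) set) \<Rightarrow> 'h monoid" where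
  "group_like_group scale \<Delta> = \<lparr>carrier = group_likes scale \<Delta>, mult = (*), one = 1\<rparr>"

definition group_like_span ::
  "('k::field \<Rightarrow> 'h::ring_1 \<Rightarrow> 'h) \<Rightarrow> ('h \<Rightarrow> ('h \<times> 'h \<Rightarrow>\<^sub>0 'k) set) \<Rightarrow> 'h set" where
  "group_like_span scale \<Delta> = module.span scale (group_likes scale \<Delta>)"

text \<open>
  For \<open>y\<close> outside \<open>C\<^sub>0 = kG(H)\<close>, the \<open>g\<close> below is unique and group-like. (Nonzero scalars satisfy
  the equation with \<open>g = 0\<close>, but they lie in \<open>C\<^sub>0\<close>.)
\<close>

definition has_weight ::
  "('k::field \<Rightarrow> 'h::ring_1 \<Rightarrow> 'h) \<Rightarrow> ('h \<Rightarrow> ('h \<times> 'h \<Rightarrow>\<^sub>0 'k) set) \<Rightarrow> 'h \<Rightarrow> 'h \<Rightarrow> bool" where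
  "has_weight scale \<Delta> y g \<longleftrightarrow> y \<noteq> 0 \<and> \<Delta> y = tensor2 scale (gen (y, 1) + gen (g, y))"

definition skew_primitive ::
  "('k::field \<Rightarrow> 'h::ring_1 \<Rightarrow> 'h) \<Rightarrow> ('h \<Rightarrow> ('h \<times> 'h \<Rightarrow>\<^sub>0 'k) set) \<Rightarrow> 'h \<Rightarrow> bool" where
  "skew_primitive scale \<Delta> y \<longleftrightarrow> (\<exists>g. has_weight scale \<Delta> y g)"

definition weight ::
  "('k::field \<Rightarrow> 'h::ring_1 \<Rightarrow> 'h) \<Rightarrow> ('h \<Rightarrow> ('h \<times> 'h \<Rightarrow>\<^sub>0 'k) set) \<Rightarrow> 'h \<Rightarrow> 'h" where
  "weight scale \<Delta> y = (THE g. has_weight scale \<Delta> y g)"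

definition nontrivial_skew_primitives ::
  "('k::field \<Rightarrow> 'h::ring_1 \<Rightarrow> 'h) \<Rightarrow> ('h \<Rightarrow> ('h \<times> 'h \<Rightarrow>\<^sub>0 'k) set) \<Rightarrow> 'h set" where
  "nontrivial_skew_primitives scale \<Delta> =
     {y. skew_primitive scale \<Delta> y \<and> y \<notin> group_like_span scale \<Delta>}"

definition weights ::
  "('k::field \<Rightarrow> 'h::ring_1 \<Rightarrow> 'h) \<Rightarrow> ('h \<Rightarrow> ('h \<times> 'h \<Rightarrow>\<^sub>0 'k) set) \<Rightarrow> 'h set" where
  "weights scale \<Delta> = weight scale \<Delta> ` nontrivial_skew_primitives scale \<Delta>"

definition is_commutator ::
  "('k::field \<Rightarrow> 'h::ring_1 \<Rightarrow> 'h) \<Rightarrow> ('h \<Rightarrow> ('h \<times> 'h \<Rightarrow>\<^sub>0 'k) set) \<Rightarrow> 'h \<Rightarrow> 'k \<Rightarrow> bool" where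
  "is_commutator scale \<Delta> y c \<longleftrightarrow> c \<noteq> 0 \<and>
     (inv\<^bsub>group_like_group scale \<Delta>\<^esub> (weight scale \<Delta> y)) * y * weight scale \<Delta> y - scale c y
       \<in> group_like_span scale \<Delta>"

definition commutators ::
  "('k::field \<Rightarrow> 'h::ring_1 \<Rightarrow> 'h) \<Rightarrow> ('h \<Rightarrow> ('h \<times> 'h \<Rightarrow>\<^sub>0 'k) set) \<Rightarrow> 'k set" where
  "commutators scale \<Delta> =
     {c. \<exists>y \<in> nontrivial_skew_primitives scale \<Delta>. is_commutator scale \<Delta> y c}"

definition weight_group ::
  "('k::field \<Rightarrow> 'h::ring_1 \<Rightarrow> 'h) \<Rightarrow> ('h \<Rightarrow> ('h \<times> 'h \<Rightarrow>\<^sub>0 'k) set) \<Rightarrow> 'h monoid" where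
  "weight_group scale \<Delta> = subgroup_generated (group_like_group scale \<Delta>) (weights scale \<Delta>)"

definition field_units :: "'k::field monoid" where
  "field_units = \<lparr>carrier = UNIV - {0}, mult = (*), one = 1\<rparr>"

definition commutator_group ::
  "('k::field \<Rightarrow> 'h::ring_1 \<Rightarrow> 'h) \<Rightarrow> ('h \<Rightarrow> ('h \<times> 'h \<Rightarrow>\<^sub>0 'k) set) \<Rightarrow> 'k monoid" where
  "commutator_group scale \<Delta> = subgroup_generated field_units (commutators scale \<Delta>)"

section \<open>Torsionfree rank\<close>

definition torsionfree :: "'a monoid \<Rightarrow> bool" where
  "torsionfree A \<longleftrightarrow>
     (\<forall>x\<in>carrier A. \<forall>n::nat. n > 0 \<longrightarrow> x [^]\<^bsub>A\<^esub> n = \<one>\<^bsub>A\<^esub> \<longrightarrow> x = \<one>\<^bsub>A\<^esub>)"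

definition int_independent :: "'a monoid \<Rightarrow> 'a set \<Rightarrow> bool" where
  "int_independent A X \<longleftrightarrow> finite X \<and> X \<subseteq> carrier A \<and>
     (\<forall>e :: 'a \<Rightarrow> int. (\<Otimes>\<^bsub>A\<^esub>x\<in>X. x [^]\<^bsub>A\<^esub> e x) = \<one>\<^bsub>A\<^esub> \<longrightarrow> (\<forall>x\<in>X. e x = 0))"

text \<open>The dimension of \<open>\<rat> \<otimes> A\<close>, all infinite values being identified with \<open>\<infinity>\<close>.\<close>

definition torsionfree_rank :: "'a monoid \<Rightarrow> enat" where
  "torsionfree_rank A = (SUP X \<in> {X. int_independent A X}. enat (card X))"

section \<open>Exponential growth\<close>

definition power_span :: "('k::field \<Rightarrow> 'h::ring_1 \<Rightarrow> 'h) \<Rightarrow> 'h set \<Rightarrow> nat \<Rightarrow> 'h set" where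
  "power_span scale V n = module.span scale {prod_list xs | xs. length xs = n \<and> set xs \<subseteq> V}"

definition exponential_growth :: "('k::field \<Rightarrow> 'h::ring_1 \<Rightarrow> 'h) \<Rightarrow> bool" where
  "exponential_growth scale \<longleftrightarrow>
     (\<exists>V. module.subspace scale V \<and> (\<exists>B. finite B \<and> V = module.span scale B) \<and> 1 \<in> V \<and>
       limsup (\<lambda>n. ereal (root n (real (vector_space.dim scale (power_span scale V n))))) > 1)"

end

theory Submission
  imports Defs
begin

text \<open>
  The growth is exponential because \<open>H\<close> contains a free algebra on two skew primitive elements.

  Write \<open>q\<close> for commutation factors in the sense \<open>y g = q g y\<close>. Since the commutators generate a
  group of rank at least two, there are nontrivial skew primitive elements \<open>y\<^sub>1, y\<^sub>2\<close> with weights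
  \<open>g\<^sub>1, g\<^sub>2\<close> whose commutators \<open>c\<^sub>1, c\<^sub>2\<close> are multiplicatively independent
  (\<open>independent_generators\<close>). Since the weights generate a torsionfree group of rank one,
  \<open>g\<^sub>1\<^sup>i = g\<^sub>2\<^sup>j\<close> with \<open>i, j \<noteq> 0\<close> (\<open>rank_one_commensurable\<close>). Hence the \<open>j\<close>-th power of conjugation
  by \<open>g\<^sub>2\<close> is a scalar on the conjugates of \<open>y\<^sub>1\<close>, and over an algebraically closed field \<open>y\<^sub>1\<close> can
  be replaced by a common eigenvector for \<open>g\<^sub>1\<close> and \<open>g\<^sub>2\<close>; likewise for \<open>y\<^sub>2\<close>
  (\<open>common_eigenvector\<close>). This gives a diagonal braiding with matrix \<open>q\<close>, where
  \<open>q\<^sub>1\<^sub>1 = c\<^sub>1\<close>, \<open>q\<^sub>2\<^sub>2 = c\<^sub>2\<close>, \<open>q\<^sub>1\<^sub>2\<^sup>j = c\<^sub>1\<^sup>i\<close> and \<open>q\<^sub>2\<^sub>1\<^sup>i = c\<^sub>2\<^sup>j\<close>.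

  The elements \<open>g w\<close>, with \<open>g\<close> group-like and \<open>w\<close> a word in \<open>y\<^sub>1, y\<^sub>2\<close>, are linearly independent
  (\<open>independent_words\<close>). By induction there are dual functionals on the elements of lower length;
  their tensor products, applied to the comultiplication of a linear relation, show that the part
  of the relation of top length \<open>n \<ge> 2\<close> is killed by all skew derivatives of the free algebra; in
  length one, independence modulo the span of the group-likes suffices. So
  it suffices that the skew derivatives have no common kernel in length \<open>n \<ge> 2\<close>, and
  \<open>skew_derivative_kernel\<close> reduces this to the full twist having no eigenvalue 1 on words of length
  at least two.
  On a word with \<open>m\<close> letters \<open>y\<^sub>1\<close> and \<open>n\<close> letters \<open>y\<^sub>2\<close> the full twist is the scalar
  \<open>c\<^sub>1\<^bsup>m(m-1)\<^esup> c\<^sub>2\<^bsup>n(n-1)\<^esup> (q\<^sub>1\<^sub>2q\<^sub>2\<^sub>1)\<^bsup>mn\<^esup>\<close>. Its power with exponent \<open>ij\<close> is a monomial in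
  \<open>c\<^sub>1\<close> and \<open>c\<^sub>2\<close>, and their independence excludes the value 1 as soon as \<open>m + n \<ge> 2\<close>
  (\<open>full_twist_nonresonant\<close>). Hence there are \<open>2\<^sup>n\<close> independent words of length \<open>n\<close>.
\<close>

section \<open>Skew derivatives of a diagonal braiding\<close>

text \<open>
  The factor for moving the letter \<open>x\<close> to the left past the word \<open>u\<close>.
\<close>

definition crossing :: "('a \<Rightarrow> 'a \<Rightarrow> 'k::field) \<Rightarrow> 'a list \<Rightarrow> 'a \<Rightarrow> 'k" where
  "crossing q u x = (\<Prod>m\<leftarrow>u. q m x)"

text \<open>
  The scalar by which the full twist of the braid group acts on the word: every pair of letters
  crosses twice.
\<close>

fun full_twist :: "('a \<Rightarrow> 'a \<Rightarrow> 'k::field) \<Rightarrow> 'a list \<Rightarrow> 'k" where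
  "full_twist q [] = 1"
| "full_twist q (x # u) = (\<Prod>m\<leftarrow>u. q x m * q m x) * full_twist q u"

text \<open>
  A function \<open>a\<close> on words stands for \<open>p = \<Sum> a(w) w\<close> in the free algebra, and the value at \<open>v\<close> is the
  coefficient of \<open>v\<close> in \<open>\<partial>\<^sub>x p\<close>. The skew derivation \<open>\<partial>\<^sub>x\<close> deletes one occurrence of \<open>x\<close>, after moving it
  to the front. Since each coefficient is a finite sum, \<open>a\<close> may be any function.
\<close>

definition skew_derivative ::
  "('a \<Rightarrow> 'a \<Rightarrow> 'k::field) \<Rightarrow> 'a \<Rightarrow> ('a list \<Rightarrow> 'k) \<Rightarrow> 'a list \<Rightarrow> 'k" where
  "skew_derivative q x a v =
     (\<Sum>k\<le>length v. crossing q (take k v) x * a (take k v @ x # drop k v))"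

text \<open>
  For \<open>e = 1\<close> this is the braid \<open>\<sigma>\<^sub>1\<dots>\<sigma>\<^sub>n\<^sub>-\<^sub>1\<close> on coefficient functions: it moves the last letter of a word
  to the front. Other weights describe the rotation of the tail of a word behind a fixed first
  letter \<open>x\<close>: the rotated letter \<open>z\<close> then crosses \<open>x\<close> twice, which costs \<open>e z = q x z * q z x\<close>.
\<close>

fun rotate_weighted ::
  "('a \<Rightarrow> 'a \<Rightarrow> 'k::field) \<Rightarrow> ('a \<Rightarrow> 'k) \<Rightarrow> ('a list \<Rightarrow> 'k) \<Rightarrow> 'a list \<Rightarrow> 'k" where
  "rotate_weighted q e a [] = a []"
| "rotate_weighted q e a (x # u) = e x * crossing q u x * a (u @ [x])"

lemma crossing_simps [simp]:
  "crossing q [] x = 1" "crossing q (m # u) x = q m x * crossing q u x"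
  "crossing q (u @ v) x = crossing q u x * crossing q v x"
  by (simp_all add: crossing_def)

lemma prod_list_mult_distrib:
  "(\<Prod>m\<leftarrow>u. f m * g m :: 'k::field) = (\<Prod>m\<leftarrow>u. f m) * (\<Prod>m\<leftarrow>u. g m)"
  by (induction u) auto

text \<open>
  Each letter of \<open>v\<close> crosses every letter of \<open>u\<close> once, and every other letter of \<open>v\<close> once
  in each of the two orders.
\<close>

lemma rotate_weighted_power:
  "(rotate_weighted q e ^^ length v) a (v @ u) =
     (\<Prod>x\<leftarrow>v. e x) * full_twist q v * (\<Prod>x\<leftarrow>v. crossing q u x) * a (u @ v)"
proof (induction v arbitrary: u)
  case (Cons z v)
  show ?case
    using Cons.IH[of "u @ [z]"]
    by (simp add: prod_list_mult_distrib algebra_simps crossing_def)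
qed auto

lemma rotate_weighted_full:
  "(rotate_weighted q e ^^ length v) a v = (\<Prod>x\<leftarrow>v. e x) * full_twist q v * a v"
proof -
  have "(\<Prod>x\<leftarrow>v. crossing q [] x) = 1" by (induction v) auto
  with rotate_weighted_power[where u = "[]" and v = v and q = q and e = e and a = a] show ?thesis by simp
qed

lemma full_twist_append:
  "full_twist q (u @ [x]) = full_twist q (x # u)"
  by (induction u) (auto simp: prod_list_mult_distrib algebra_simps)

lemma rotate_weighted_cong:
  assumes "\<And>w. length w = n \<Longrightarrow> a w = b w" "length w = n"
  shows "rotate_weighted q e a w = rotate_weighted q e b w"
  using assms by (cases w) auto

lemma rotate_weighted_fixed_eq_0:
  assumes fixed: "\<And>w. length w = n \<Longrightarrow> rotate_weighted q e a w = a w"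
    and "length w = n" and "(\<Prod>x\<leftarrow>w. e x) * full_twist q w \<noteq> 1"
  shows "a w = 0"
proof -
  have "(rotate_weighted q e ^^ k) a v = a v" if "length v = n" for k v
    using that
  proof (induction k arbitrary: v)
    case (Suc k)
    show ?case using rotate_weighted_cong[OF Suc.IH Suc.prems] fixed[OF Suc.prems] by simp
  qed auto
  from this[OF assms(2), of "length w"] rotate_weighted_full[where v = w and q = q and e = e and a = a] assms(3)
  show ?thesis by auto
qed

text \<open>
  The \<open>n\<close>-th power of the rotation is the full twist, a scalar different from 1 that does not change
  under rotation. So the identity minus the rotation is inverted by a finite geometric series.
\<close>

lemma rotation_preimage:
  assumes nonres: "\<And>w. length w = n \<Longrightarrow> full_twist q w \<noteq> 1"
  obtains r where "\<And>w. length w = n \<Longrightarrow> a w = r w - rotate_weighted q (\<lambda>_. 1) r w"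
proof
  let ?R = "rotate_weighted q (\<lambda>_. 1)"
  define r where "r w = (\<Sum>k<n. (?R ^^ k) a w) / (1 - full_twist q w)" for w
  fix w :: "'a list" assume n: "length w = n"
  have rot: "?R r w = (\<Sum>k<n. (?R ^^ Suc k) a w) / (1 - full_twist q w)"
  proof (cases w)
    case Nil
    then show ?thesis using n by (simp add: r_def)
  next
    case (Cons x u)
    then show ?thesis
      by (simp add: r_def full_twist_append sum_distrib_left)
  qed
  have "(\<Prod>x\<leftarrow>w. (1::'b)) = 1" by (induction w) auto
  then have full: "(?R ^^ n) a w = full_twist q w * a w"
    using rotate_weighted_full[where q = q and e = "\<lambda>_. 1" and v = w] n by simp
  have "(\<Sum>k<n. (?R ^^ k) a w) - (\<Sum>k<n. (?R ^^ Suc k) a w) = a w - (?R ^^ n) a w"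
    using sum_lessThan_telescope'[of "\<lambda>k. (?R ^^ k) a w" n]
    by (simp add: sum_subtractf)
  then have "r w - ?R r w = (a w - (?R ^^ n) a w) / (1 - full_twist q w)"
    by (simp only: rot r_def diff_divide_distrib[symmetric])
  also have "\<dots> = a w" using nonres[OF n] by (simp add: full field_simps)
  finally show "a w = r w - ?R r w" by simp
qed

lemma skew_derivative_snoc:
  "skew_derivative q x a (v @ [z]) =
     skew_derivative q x (\<lambda>w. a (w @ [z])) v + crossing q (v @ [z]) x * a (v @ [z, x])"
  unfolding skew_derivative_def by (simp add: sum.atMost_Suc)

text \<open>
  Rotate, then take out \<open>x\<close>: either \<open>x\<close> itself was the rotated letter, or \<open>z\<close> was rotated, and then
  \<open>z\<close> and \<open>x\<close> cross each other twice.
\<close>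

lemma skew_derivative_rotation:
  "skew_derivative q x (rotate_weighted q (\<lambda>_. 1) r) (z # v) =
     crossing q (z # v) x * r (z # v @ [x]) +
     q z x * q x z * crossing q v z * skew_derivative q x (\<lambda>w. r (w @ [z])) v"
proof -
  have "crossing q (take k v @ x # drop k v) z = crossing q v z * q x z" for k
  proof -
    have "crossing q v z = crossing q (take k v) z * crossing q (drop k v) z"
      by (metis append_take_drop_id crossing_simps(3))
    then show ?thesis by simp
  qed
  then show ?thesis
    unfolding skew_derivative_def
    by (simp add: sum.atMost_Suc_shift sum_distrib_left algebra_simps del: crossing_simps(3) sum.atMost_Suc)
qed

text \<open>
  Let \<open>T\<^sub>n = 1 + \<sigma>\<^sub>1 + \<sigma>\<^sub>1\<sigma>\<^sub>2 + \<dots> + \<sigma>\<^sub>1\<dots>\<sigma>\<^sub>n\<^sub>-\<^sub>1\<close>, whose components are the skew derivatives in length \<open>n\<close>.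
  With \<open>C = \<sigma>\<^sub>1\<dots>\<sigma>\<^sub>n\<^sub>-\<^sub>1\<close> and \<open>B = \<sigma>\<^sub>1\<sigma>\<^sub>1\<sigma>\<^sub>2\<dots>\<sigma>\<^sub>n\<^sub>-\<^sub>1\<close> there is the factorization
  \<open>T\<^sub>n (1 - C) = (1 - B) (T\<^sub>n\<^sub>-\<^sub>1 \<otimes> 1)\<close>, and both \<open>C\<^sup>n\<close> and \<open>B\<^sup>n\<^sup>-\<^sup>1\<close> are the full twist. If the full twist never is 1, then
  \<open>1 - C\<close> is onto and \<open>1 - B\<close> is injective, so injectivity passes from \<open>T\<^sub>n\<^sub>-\<^sub>1\<close> to \<open>T\<^sub>n\<close>.
\<close>

theorem skew_derivative_kernel:
  assumes nonres: "\<And>w. 2 \<le> length w \<Longrightarrow> full_twist q w \<noteq> 1"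
    and deriv: "\<And>x v. length v = n \<Longrightarrow> skew_derivative q x a v = 0"
    and "length w = Suc n"
  shows "a w = 0"
  using deriv \<open>length w = Suc n\<close>
proof (induction n arbitrary: a w)
  case 0
  then show ?case
    using "0.prems"(1)[of "[]" "hd w"] by (cases w) (auto simp: skew_derivative_def)
next
  case (Suc n)
  obtain r where r: "\<And>w. length w = Suc (Suc n) \<Longrightarrow>
      a w = r w - rotate_weighted q (\<lambda>_. 1) r w"
    using rotation_preimage[of "Suc (Suc n)" q a] nonres by auto
  \<comment> \<open>The coefficient of \<open>x # v\<close> in \<open>(T \<otimes> 1) r\<close>, where \<open>T\<close> acts on all letters but the last.\<close>
  define F where "F x v = skew_derivative q x (\<lambda>w. r (w @ [last v])) (butlast v)" for x v
  have F: "skew_derivative q x r v = F x v + crossing q v x * r (v @ [x])"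
    if "length v = Suc n" for x v
    using that skew_derivative_snoc[of q x r "butlast v" "last v"]
    by (cases v rule: rev_cases) (auto simp: F_def)
  \<comment> \<open>That is, \<open>(1 - B) (T \<otimes> 1) r = 0\<close>; the terms in which \<open>x\<close> is the last letter cancel.\<close>
  have fixed: "rotate_weighted q (\<lambda>z. q x z * q z x) (F x) v = F x v"
    if len: "length v = Suc n" for x v
  proof -
    obtain z u where v: "v = z # u" using len by (cases v) auto
    have "0 = skew_derivative q x a v" using Suc.prems(1) len by simp
    also have "\<dots> = skew_derivative q x r v
        - skew_derivative q x (rotate_weighted q (\<lambda>_. 1) r) v"
      unfolding skew_derivative_def sum_subtractf[symmetric]
      by (rule sum.cong) (simp_all add: r len algebra_simps)
    finally show ?thesis
      using F[OF len, of x] by (simp add: v skew_derivative_rotation F_def algebra_simps)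
  qed
  have F0: "F x v = 0" if "length v = Suc n" for x v
  proof (rule rotate_weighted_fixed_eq_0[OF fixed that])
    show "(\<Prod>z\<leftarrow>v. q x z * q z x) * full_twist q v \<noteq> 1"
      using nonres[of "x # v"] that by simp
  qed
  have r0: "r v = 0" if len: "length v = Suc (Suc n)" for v
  proof -
    have "r (butlast v @ [last v]) = 0"
    proof (rule Suc.IH[where a = "\<lambda>w. r (w @ [last v])" and w = "butlast v"])
      show "skew_derivative q x (\<lambda>w. r (w @ [last v])) u = 0" if "length u = n" for x u
        using F0[of "u @ [last v]" x] that by (simp add: F_def)
    qed (use len in simp)
    then show ?thesis using len by (cases v rule: rev_cases) auto
  qed
  show ?case
    using r[OF Suc.prems(2)] rotate_weighted_cong[of "Suc (Suc n)" r "\<lambda>_. 0" w q "\<lambda>_. 1"]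
    using r0 Suc.prems(2) by (cases w) auto
qed

text \<open>
  The terms of \<open>\<Delta>(w)\<close>. A letter of \<open>w\<close> contributes \<open>y \<otimes> 1\<close> or \<open>g \<otimes> y\<close>, so a term is determined by the
  word \<open>u\<close> of letters of the first kind and the word \<open>v\<close> of letters of the second kind; the scalar
  arises from collecting the group-like elements of \<open>v\<close> on the left of the letters of \<open>u\<close>.
\<close>

fun unshuffle :: "('a \<Rightarrow> 'a \<Rightarrow> 'k::field) \<Rightarrow> 'a list \<Rightarrow> ('k \<times> 'a list \<times> 'a list) list" where
  "unshuffle q [] = [(1, [], [])]"
| "unshuffle q (x # w) =
     map (\<lambda>(c, u, v). (c * (\<Prod>m\<leftarrow>v. q x m), x # u, v)) (unshuffle q w) @
     map (\<lambda>(c, u, v). (c, u, x # v)) (unshuffle q w)"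

lemma unshuffle_length: "(c, u, v) \<in> set (unshuffle q w) \<Longrightarrow> length u + length v = length w"
  by (induction w arbitrary: c u v) auto

definition unshuffle_coeff :: "('a \<Rightarrow> 'a \<Rightarrow> 'k::field) \<Rightarrow> 'a list \<Rightarrow> 'a list \<Rightarrow> 'a list \<Rightarrow> 'k" where
  "unshuffle_coeff q w u v = (\<Sum>(c, u', v')\<leftarrow>unshuffle q w. if u' = u \<and> v' = v then c else 0)"

lemma sum_list_if_const:
  "(\<Sum>x\<leftarrow>xs. if P \<and> Q x then f x else 0) =
     (if P then (\<Sum>x\<leftarrow>xs. if Q x then f x else 0) else (0::'k::field))"
  by (induction xs) auto

lemma unshuffle_coeff_Nil_right: "unshuffle_coeff q w u [] = (if w = u then 1 else 0)"
proof (induction w arbitrary: u)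
  case Nil
  then show ?case by (simp add: unshuffle_coeff_def)
next
  case (Cons x w)
  have "unshuffle_coeff q (x # w) u [] = (case u of [] \<Rightarrow> 0 | z # u' \<Rightarrow> if x = z then unshuffle_coeff q w u' [] else 0)"
    by (cases u)
      (auto simp: unshuffle_coeff_def o_def case_prod_unfold sum_list_if_const
        intro!: arg_cong[of _ _ sum_list] map_cong cong: if_cong)
  then show ?case using Cons.IH by (cases u) auto
qed

lemma unshuffle_coeff_Cons:
  "unshuffle_coeff q (z # w) u [x] =
     (case u of [] \<Rightarrow> 0 | z' # u' \<Rightarrow> if z = z' then q z x * unshuffle_coeff q w u' [x] else 0)
     + (if z = x \<and> w = u then 1 else 0)"
proof -
  have 1: "(\<Sum>(c, u', v')\<leftarrow>unshuffle q w. if z # u' = u \<and> v' = [x] then c * (\<Prod>m\<leftarrow>v'. q z m) else 0)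
      = (case u of [] \<Rightarrow> 0 | z' # u' \<Rightarrow> if z = z' then q z x * unshuffle_coeff q w u' [x] else 0)"
    by (cases u) (auto simp: unshuffle_coeff_def case_prod_unfold sum_list_if_const mult.commute
        sum_list_const_mult[symmetric] intro!: arg_cong[of _ _ sum_list] map_cong)
  have 2: "(\<Sum>(c, u', v')\<leftarrow>unshuffle q w. if u' = u \<and> z # v' = [x] then c else 0)
      = (if z = x then unshuffle_coeff q w u [] else 0)"
    by (auto simp: unshuffle_coeff_def case_prod_unfold)
  have "unshuffle_coeff q (z # w) u [x] =
      (\<Sum>(c, u', v')\<leftarrow>unshuffle q w. if z # u' = u \<and> v' = [x] then c * (\<Prod>m\<leftarrow>v'. q z m) else 0) +
      (\<Sum>(c, u', v')\<leftarrow>unshuffle q w. if u' = u \<and> z # v' = [x] then c else 0)"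
    by (simp add: unshuffle_coeff_def o_def case_prod_unfold cong: if_cong)
  then show ?thesis unfolding 1 2 by (auto simp: unshuffle_coeff_Nil_right)
qed

lemma finite_words: "finite {w :: 'a::finite list. length w = n}"
  using finite_lists_length_eq[of "UNIV :: 'a set" n] by simp

lemma sum_words_Suc:
  "(\<Sum>w | length w = Suc n. f w) = (\<Sum>z\<in>UNIV. \<Sum>w | length w = n. f (z # (w :: 'a::finite list)))"
proof -
  have "{w :: 'a list. length w = Suc n} = (\<lambda>(z, w). z # w) ` (UNIV \<times> {w. length w = n})"
    by (auto simp: length_Suc_conv)
  then have "(\<Sum>w | length w = Suc n. f w) = (\<Sum>p\<in>UNIV \<times> {w. length w = n}. f (fst p # snd p))"
    by (simp add: sum.reindex inj_on_def case_prod_unfold)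
  then show ?thesis by (simp add: sum.cartesian_product case_prod_unfold)
qed

text \<open>
  The component of the comultiplication whose right factor has length one consists of the skew
  derivatives.
\<close>

lemma sum_unshuffle_coeff:
  fixes a :: "'a::finite list \<Rightarrow> 'k::field"
  shows "(\<Sum>w | length w = Suc (length u). a w * unshuffle_coeff q w u [x]) = skew_derivative q x a u"
proof (induction u arbitrary: a)
  case Nil
  have "(\<Sum>w | length w = Suc 0. a w * unshuffle_coeff q w [] [x]) = (\<Sum>z\<in>UNIV. if z = x then a [z] else 0)"
    unfolding sum_words_Suc by (intro sum.cong) (auto simp: unshuffle_coeff_Cons)
  then show ?case by (simp add: skew_derivative_def)
next
  case (Cons z u)
  have "(\<Sum>w | length w = Suc (length (z # u)). a w * unshuffle_coeff q w (z # u) [x])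
      = (\<Sum>y\<in>UNIV. \<Sum>w | length w = Suc (length u).
          (if y = z then q z x * (a (z # w) * unshuffle_coeff q w u [x]) else 0)
          + (if w = z # u then if y = x then a (x # z # u) else 0 else 0))"
    unfolding sum_words_Suc[of _ "length (z # u)"]
    by (intro sum.cong) (auto simp: unshuffle_coeff_Cons algebra_simps)
  also have "\<dots> = (\<Sum>y\<in>UNIV. if y = z then q z x * skew_derivative q x (\<lambda>w. a (z # w)) u else 0)
      + (\<Sum>y\<in>UNIV. if y = x then a (x # z # u) else 0)"
    unfolding sum.distrib[symmetric]
  proof (intro sum.cong refl)
    fix y
    show "(\<Sum>w | length w = Suc (length u).
          (if y = z then q z x * (a (z # w) * unshuffle_coeff q w u [x]) else 0)
          + (if w = z # u then if y = x then a (x # z # u) else 0 else 0))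
        = (if y = z then q z x * skew_derivative q x (\<lambda>w. a (z # w)) u else 0)
          + (if y = x then a (x # z # u) else 0)"
      unfolding sum.distrib
      by (simp add: finite_words sum_distrib_left[symmetric] Cons.IH[symmetric])
  qed
  also have "\<dots> = skew_derivative q x a (z # u)"
    by (simp add: skew_derivative_def sum.atMost_Suc_shift sum_distrib_left mult.assoc
        del: sum.atMost_Suc)
  finally show ?case .
qed

section \<open>Full twists for two letters\<close>

lemma full_twist_two_letters:
  fixes q :: "bool \<Rightarrow> bool \<Rightarrow> 'k::field"
  defines "n1 w \<equiv> count_list w False" and "n2 w \<equiv> count_list w True"
  shows "full_twist q w = q False False ^ (n1 w * (n1 w - 1)) * q True True ^ (n2 w * (n2 w - 1))
    * (q False True * q True False) ^ (n1 w * n2 w)"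
proof (induction w)
  case Nil
  then show ?case by (simp add: n1_def n2_def)
next
  case (Cons x w)
  have suc: "Suc n * (Suc n - 1) = n * (n - 1) + 2 * n" for n :: nat by (cases n) auto
  have F: "(\<Prod>m\<leftarrow>w. q False m * q m False) = q False False ^ (2 * n1 w) * (q False True * q True False) ^ n2 w"
    by (induction w) (auto simp: n1_def n2_def power2_eq_square algebra_simps)
  have T: "(\<Prod>m\<leftarrow>w. q True m * q m True) = q True True ^ (2 * n2 w) * (q False True * q True False) ^ n1 w"
    by (induction w) (auto simp: n1_def n2_def power2_eq_square algebra_simps)
  show ?case
  proof (cases x)
    case True
    then have "n1 (x # w) = n1 w" "n2 (x # w) = Suc (n2 w)" by (auto simp: n1_def n2_def)
    then show ?thesis using True
      by (simp only: full_twist.simps T Cons.IH suc power_add mult_Suc_right[of "n1 w" "n2 w"]) (simp only: mult_ac)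
  next
    case False
    then have "n1 (x # w) = Suc (n1 w)" "n2 (x # w) = n2 w" by (auto simp: n1_def n2_def)
    then show ?thesis using False
      by (simp only: full_twist.simps F Cons.IH suc power_add mult_Suc[of "n1 w" "n2 w"]) (simp only: mult_ac)
  qed
qed

text \<open>
  Raising to the power \<open>i * j\<close> expresses the mixed entries of \<open>q\<close> by the diagonal ones. For letter
  counts \<open>M\<close> and \<open>N\<close> a full twist equal to 1 would force \<open>M = 0\<close> or \<open>(M - 1) j + i N = 0\<close>, and
  symmetrically \<open>N = 0\<close> or \<open>(N - 1) i + j M = 0\<close>. If both counts are positive, this gives \<open>i = j\<close> and
  \<open>M + N = 1\<close>; if one count vanishes, the other is at most 1.
\<close>

lemma full_twist_nonresonant:
  fixes q :: "bool \<Rightarrow> bool \<Rightarrow> 'k::field"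
  assumes indep: "\<And>m n. q False False powi m * q True True powi n = 1 \<Longrightarrow> m = 0 \<and> n = 0"
    and nz: "q False False \<noteq> 0" "q True True \<noteq> 0" "i \<noteq> 0" "j \<noteq> 0"
    and mixed: "q False True powi j = q False False powi i" "q True False powi i = q True True powi j"
    and len: "2 \<le> length w"
  shows "full_twist q w \<noteq> 1"
proof
  assume 1: "full_twist q w = 1"
  define c d where "c = q False False" and "d = q True True"
  define m n where "m = count_list w False" and "n = count_list w True"
  define M N where "M = int m" and "N = int n"
  have mn: "m + n = length w" unfolding m_def n_def by (induction w) auto
  have pred: "int (k * (k - 1)) = int k * (int k - 1)" for k :: nat by (cases k) (auto simp: algebra_simps)
  have "1 = (c ^ (m * (m - 1)) * d ^ (n * (n - 1)) * (q False True * q True False) ^ (m * n)) powi (i * j)"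
    using 1 unfolding full_twist_two_letters c_def d_def m_def n_def by simp
  also have "\<dots> = c powi (M * (M - 1) * (i * j)) * d powi (N * (N - 1) * (i * j))
      * ((q False True powi j) powi (i * (M * N)) * (q True False powi i) powi (j * (M * N)))"
    by (simp add: M_def N_def power_int_mult_distrib mult_ac pred[symmetric]
        flip: power_int_of_nat power_int_mult)
  also have "\<dots> = c powi (M * (M - 1) * (i * j) + i * (i * (M * N)))
      * d powi (N * (N - 1) * (i * j) + j * (j * (M * N)))"
    using nz by (simp add: mixed c_def d_def power_int_add mult_ac flip: power_int_mult)
  finally have "M * (M - 1) * (i * j) + i * (i * (M * N)) = 0 \<and> N * (N - 1) * (i * j) + j * (j * (M * N)) = 0"
    using indep unfolding c_def d_def by metis
  then have "i * (M * ((M - 1) * j + i * N)) = 0" "j * (N * ((N - 1) * i + j * M)) = 0"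
    by (simp_all add: algebra_simps)
  then have e: "M = 0 \<or> (M - 1) * j + i * N = 0" "N = 0 \<or> (N - 1) * i + j * M = 0"
    using nz by auto
  show False
  proof (cases "M = 0 \<or> N = 0")
    case True
    then show ?thesis using e nz mn len by (auto simp: M_def N_def)
  next
    case False
    with e have eqs: "(M - 1) * j + i * N = 0" "(N - 1) * i + j * M = 0" by auto
    then have "i = j" by (simp add: algebra_simps)
    with eqs(1) have "j * (M + N - 1) = 0" by (simp add: algebra_simps)
    then show ?thesis using nz mn len by (simp add: M_def N_def)
  qed
qed

section \<open>Eigenvectors and dual functionals\<close>

text \<open>
  Some nonzero polynomial in \<open>T\<close> kills \<open>y\<close>. Split off linear factors one at a time, until one of them kills
  a nonzero vector.
\<close>

lemma eigenvector_exists: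
  fixes scale :: "'k::alg_closed_field \<Rightarrow> 'v::ab_group_add \<Rightarrow> 'v"
  assumes T: "Vector_Spaces.linear scale scale T"
    and K: "module.subspace scale K" "\<And>v. v \<in> K \<Longrightarrow> T v \<in> K"
    and y: "y \<in> K" "y \<noteq> 0" and b: "0 < b" "(T ^^ b) y = scale s y"
  obtains v \<mu> where "v \<in> K" "v \<noteq> 0" "T v = scale \<mu> v"
proof -
  interpret Vector_Spaces.linear scale scale T by fact
  \<comment> \<open>The vector \<open>p(T) y\<close>, by the Horner scheme.\<close>
  define ev where "ev p = fold_coeffs (\<lambda>a w. scale a y + T w) p 0" for p
  have ev_0 [simp]: "ev 0 = 0" by (simp add: ev_def)
  have ev_pCons [simp]: "ev (pCons a p) = scale a y + T (ev p)" for a p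
    by (cases "a = 0 \<and> p = 0") (auto simp: ev_def zero)
  have ev_add: "ev (p + q) = ev p + ev q" for p q
  proof (induction p arbitrary: q)
    case (pCons a p)
    obtain c r where q: "q = pCons c r" by (cases q)
    have "ev (pCons a p + q) = scale (a + c) y + T (ev (p + r))" by (simp add: q)
    also have "\<dots> = ev (pCons a p) + ev q"
      unfolding pCons.IH by (simp add: q add vs1.scale_left_distrib)
    finally show ?case .
  qed simp
  have ev_smult: "ev (smult c p) = scale c (ev p)" for c p
    by (induction p) (simp_all add: scale vs1.scale_right_distrib)
  have ev_monom: "ev (monom 1 n) = (T ^^ n) y" for n
    by (induction n) (simp_all add: monom_Suc monom_0 zero)
  have ev_K: "ev p \<in> K" for p
    by (induction p) (simp_all add: K y vs1.subspace_0 vs1.subspace_add vs1.subspace_scale)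
  have *: "\<exists>v\<in>K. v \<noteq> 0 \<and> (\<exists>\<mu>. T v = scale \<mu> v)" if "p \<noteq> 0" "ev p = 0" for p
    using that
  proof (induction "degree p" arbitrary: p rule: less_induct)
    case less
    have "degree p > 0"
    proof (rule ccontr)
      assume "\<not> degree p > 0"
      then obtain a where "p = [:a:]" by (auto elim: degree_eq_zeroE)
      with less.prems y(2) show False by (simp add: zero)
    qed
    then obtain \<mu> where "poly p \<mu> = 0" using alg_closed_imp_poly_has_root by blast
    then obtain q where q: "p = [:- \<mu>, 1:] * q" by (auto simp: poly_eq_0_iff_dvd elim: dvdE)
    with less.prems have "q \<noteq> 0" by auto
    then have deg: "degree p = Suc (degree q)" unfolding q by (subst degree_mult_eq) auto
    have ev_q: "T (ev q) = scale \<mu> (ev q)"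
    proof -
      have "p = smult (- \<mu>) q + pCons 0 q" unfolding q by simp
      then have "ev p = scale (- \<mu>) (ev q) + T (ev q)"
        by (simp only: ev_add ev_smult ev_pCons vs1.scale_zero_left add_0)
      then show ?thesis using less.prems(2) by simp
    qed
    show ?case
    proof (cases "ev q = 0")
      case True
      show ?thesis by (rule less.hyps[OF _ \<open>q \<noteq> 0\<close> True]) (simp add: deg)
    qed (use ev_q ev_K in blast)
  qed
  define p where "p = monom 1 b + [:- s:]"
  have "coeff p b = 1" using b(1) by (cases b) (auto simp: p_def)
  then have "p \<noteq> 0" by auto
  moreover have "ev p = 0" by (simp add: p_def ev_add ev_monom b(2) zero)
  ultimately show thesis using * that by blast
qed

text \<open>
  A family rather than a set, so that independence of words also says that distinct words are
  distinct elements.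
\<close>

definition independent_family ::
  "('k::field \<Rightarrow> 'v::ab_group_add \<Rightarrow> 'v) \<Rightarrow> ('i \<Rightarrow> 'v) \<Rightarrow> 'i set \<Rightarrow> bool" where
  "independent_family scale E I \<longleftrightarrow>
     (\<forall>A a. finite A \<longrightarrow> A \<subseteq> I \<longrightarrow> (\<Sum>i\<in>A. scale (a i) (E i)) = 0 \<longrightarrow> (\<forall>i\<in>A. a i = 0))"

context vector_space
begin

lemma functional_separating:
  assumes "x \<notin> span U"
  obtains \<psi> where "Vector_Spaces.linear scale (*) \<psi>" "\<psi> x = 1" "\<And>u. u \<in> span U \<Longrightarrow> \<psi> u = 0"
proof -
  interpret functional: vector_space_pair scale "(*)"
    by unfold_locales (auto simp: algebra_simps)
  obtain B where B: "B \<subseteq> U" "independent B" "U \<subseteq> span B"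
    using maximal_independent_subset by blast
  then have span: "span B = span U" by (meson span_mono span_minimal subspace_span subset_antisym)
  then have "independent (insert x B)"
    using assms B(2) by (auto simp: independent_insert)
  from functional.linear_independent_extend[OF this, of "\<lambda>v. if v = x then 1 else 0"]
  obtain \<psi> where \<psi>: "Vector_Spaces.linear scale (*) \<psi>"
    "\<And>v. v \<in> insert x B \<Longrightarrow> \<psi> v = (if v = x then 1 else 0)"
    by blast
  have "x \<notin> B" using assms span by (metis span_base)
  then have "\<psi> u = 0" if "u \<in> span B" for u
    using functional.linear_eq_0_on_span[OF \<psi>(1) _ that] \<psi>(2) by (metis insertI2)
  with that[of \<psi>] \<psi> show thesis by (simp add: span)
qed

lemma dual_functional:
  assumes "independent_family scale E I" "i \<in> I"
  obtains \<psi> where "Vector_Spaces.linear scale (*) \<psi>"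
    "\<And>j. j \<in> I \<Longrightarrow> \<psi> (E j) = (if j = i then 1 else 0)"
proof -
  have "E i \<notin> span (E ` (I - {i}))"
  proof
    assume "E i \<in> span (E ` (I - {i}))"
    then obtain t r where t: "finite t" "t \<subseteq> E ` (I - {i})" "E i = (\<Sum>a\<in>t. scale (r a) a)"
      by (auto simp: span_explicit)
    then obtain A where A: "A \<subseteq> I - {i}" "inj_on E A" "t = E ` A"
      by (auto simp: subset_image_inj)
    then have "finite A" using t(1) finite_image_iff by blast
    let ?a = "\<lambda>j. if j = i then - 1 else r (E j)"
    have "(\<Sum>j\<in>A. scale (?a j) (E j)) = (\<Sum>j\<in>A. scale (r (E j)) (E j))"
      using A(1) by (intro sum.cong) auto
    then have "(\<Sum>j\<in>insert i A. scale (?a j) (E j)) = 0"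
      using A t(3) \<open>finite A\<close> by (subst sum.insert) (auto simp: sum.reindex)
    then have "?a i = 0"
      using assms(1)[unfolded independent_family_def, rule_format, of "insert i A" ?a i]
        A(1) assms(2) \<open>finite A\<close> by blast
    then show False by simp
  qed
  then obtain \<psi> where \<psi>: "Vector_Spaces.linear scale (*) \<psi>" "\<psi> (E i) = 1"
    "\<And>u. u \<in> span (E ` (I - {i})) \<Longrightarrow> \<psi> u = 0"
    by (rule functional_separating) blast
  have "\<psi> (E j) = (if j = i then 1 else 0)" if "j \<in> I" for j
    using \<psi>(2) \<psi>(3)[OF span_base, of "E j"] that by auto
  with \<psi>(1) that show thesis by blast
qed

end

section \<open>Torsionfree rank\<close>

lemma int_independent_pair:
  assumes "comm_group A" and X: "int_independent A X" "x \<in> X" "x' \<in> X" "x \<noteq> x'"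
    and rel: "x [^]\<^bsub>A\<^esub> (i::int) \<otimes>\<^bsub>A\<^esub> x' [^]\<^bsub>A\<^esub> (j::int) = \<one>\<^bsub>A\<^esub>"
  shows "i = 0 \<and> j = 0"
proof -
  interpret comm_group A by fact
  define e where "e z = (if z = x then i else if z = x' then j else 0)" for z
  let ?Y = "X - {x, x'}"
  have carrier: "X \<subseteq> carrier A" "finite X" using X(1) by (auto simp: int_independent_def)
  have "(\<Otimes>\<^bsub>A\<^esub>z\<in>?Y. z [^]\<^bsub>A\<^esub> e z) = \<one>\<^bsub>A\<^esub>"
    by (rule finprod_one_eqI) (auto simp: e_def)
  moreover have "X = insert x (insert x' ?Y)" using X by auto
  then have "(\<Otimes>\<^bsub>A\<^esub>z\<in>X. z [^]\<^bsub>A\<^esub> e z) = (\<Otimes>\<^bsub>A\<^esub>z\<in>insert x (insert x' ?Y). z [^]\<^bsub>A\<^esub> e z)"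
    by simp
  then have "(\<Otimes>\<^bsub>A\<^esub>z\<in>X. z [^]\<^bsub>A\<^esub> e z)
      = x [^]\<^bsub>A\<^esub> e x \<otimes>\<^bsub>A\<^esub> (x' [^]\<^bsub>A\<^esub> e x' \<otimes>\<^bsub>A\<^esub> (\<Otimes>\<^bsub>A\<^esub>z\<in>?Y. z [^]\<^bsub>A\<^esub> e z))"
    using X carrier by (simp add: finprod_insert Pi_def subset_iff)
  ultimately have "(\<Otimes>\<^bsub>A\<^esub>z\<in>X. z [^]\<^bsub>A\<^esub> e z) = \<one>\<^bsub>A\<^esub>"
    using rel X carrier by (simp add: e_def subset_iff)
  then have "\<forall>z\<in>X. e z = 0" using X(1) unfolding int_independent_def by blast
  then show ?thesis using X by (auto simp: e_def)
qed

text \<open>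
  Two elements are always dependent in rank one, and an exponent in their relation can only vanish if the
  other element has finite order.
\<close>

lemma rank_one_commensurable:
  assumes "comm_group A" and tf: "torsionfree A" and rank: "torsionfree_rank A = 1"
    and g: "g \<in> carrier A" "g \<noteq> \<one>\<^bsub>A\<^esub>" and h: "h \<in> carrier A" "h \<noteq> \<one>\<^bsub>A\<^esub>"
  obtains i j :: int where "i \<noteq> 0" "j \<noteq> 0" "g [^]\<^bsub>A\<^esub> i = h [^]\<^bsub>A\<^esub> j"
proof -
  interpret comm_group A by fact
  have torsion: "i = 0" if x: "x \<in> carrier A" "x \<noteq> \<one>\<^bsub>A\<^esub>" "x [^]\<^bsub>A\<^esub> i = \<one>\<^bsub>A\<^esub>" for x and i :: int
  proof (rule ccontr)
    assume "i \<noteq> 0"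
    have "x [^]\<^bsub>A\<^esub> nat \<bar>i\<bar> = \<one>\<^bsub>A\<^esub>"
      using x int_pow_neg[of x i] by (simp add: int_pow_int[symmetric] abs_if)
    with tf x \<open>i \<noteq> 0\<close> show False
      unfolding torsionfree_def by (metis zero_less_abs_iff zero_less_nat_eq)
  qed
  show thesis
  proof (cases "g = h")
    case True
    then show thesis using that[of 1 1] by simp
  next
    case False
    have "\<not> int_independent A {g, h}"
    proof
      assume "int_independent A {g, h}"
      then have "enat (card {g, h}) \<le> torsionfree_rank A"
        unfolding torsionfree_rank_def by (intro SUP_upper) auto
      then show False using False rank by (simp add: one_enat_def)
    qed
    then obtain e :: "_ \<Rightarrow> int" where
      e: "(\<Otimes>\<^bsub>A\<^esub>x\<in>{g, h}. x [^]\<^bsub>A\<^esub> e x) = \<one>\<^bsub>A\<^esub>" "e g \<noteq> 0 \<or> e h \<noteq> 0"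
      using g h by (auto simp: int_independent_def)
    then have rel: "g [^]\<^bsub>A\<^esub> e g \<otimes>\<^bsub>A\<^esub> h [^]\<^bsub>A\<^esub> e h = \<one>\<^bsub>A\<^esub>"
      using g h False by (simp add: finprod_insert)
    then have "g [^]\<^bsub>A\<^esub> e g = h [^]\<^bsub>A\<^esub> (- e h)"
      using g h by (simp add: int_pow_neg inv_equality[symmetric] eq_commute)
    moreover have "e g \<noteq> 0" using rel e(2) torsion[OF h, of "e h"] g h by auto
    moreover have "e h \<noteq> 0" using rel e(2) torsion[OF g, of "e g"] g h by auto
    ultimately show thesis using that[of "e g" "- e h"] by simp
  qed
qed

lemma comm_group_field_units: "comm_group (field_units :: 'k::field monoid)"
proof (rule comm_groupI)
  fix x :: 'k assume "x \<in> carrier field_units"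
  then show "\<exists>y\<in>carrier field_units. y \<otimes>\<^bsub>field_units\<^esub> x = \<one>\<^bsub>field_units\<^esub>"
    by (intro bexI[of _ "inverse x"]) (auto simp: field_units_def)
qed (auto simp: field_units_def)

lemma inv_field_units: "x \<noteq> 0 \<Longrightarrow> inv\<^bsub>field_units\<^esub> x = inverse (x :: 'k::field)"
proof -
  assume "x \<noteq> 0"
  interpret comm_group "field_units :: 'k monoid" by (rule comm_group_field_units)
  show ?thesis by (rule inv_equality) (use \<open>x \<noteq> 0\<close> in \<open>auto simp: field_units_def\<close>)
qed

lemma int_pow_field_units:
  assumes "x \<noteq> 0"
  shows "x [^]\<^bsub>field_units\<^esub> (i::int) = (x :: 'k::field) powi i"
proof -
  interpret comm_group "field_units :: 'k monoid" by (rule comm_group_field_units)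
  have nat: "x [^]\<^bsub>field_units\<^esub> (n::nat) = x ^ n" for n
    by (induction n) (auto simp: field_units_def nat_pow_def)
  show ?thesis using assms
    by (auto simp: int_pow_def2 power_int_def nat inv_field_units power_inverse)
qed

text \<open>
  If any two elements of \<open>\<Gamma>\<close> were dependent, there would be \<open>c\<close> (an element of infinite order in \<open>\<Gamma>\<close>, or 1 if there is none) such that
  every element of \<open>\<Gamma>\<close> has a power, with nonzero exponent, that is a power of \<open>c\<close>. The elements with this property form a
  subgroup, and any two elements of such a subgroup are dependent.
\<close>

lemma independent_generators:
  fixes \<Gamma> :: "'k::field set"
  assumes rank: "torsionfree_rank (subgroup_generated field_units \<Gamma>) > 1" and "0 \<notin> \<Gamma>"
  obtains c d where "c \<in> \<Gamma>" "d \<in> \<Gamma>" "\<And>i j. c powi i * d powi j = 1 \<Longrightarrow> i = 0 \<and> j = 0"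
proof (rule ccontr)
  note generatorsI = that
  assume "\<not> thesis"
  then have dep: "\<exists>i j. (i \<noteq> 0 \<or> j \<noteq> 0) \<and> c powi i * d powi j = 1" if "c \<in> \<Gamma>" "d \<in> \<Gamma>" for c d
    using that generatorsI by blast
  interpret U: comm_group "field_units :: 'k monoid" by (rule comm_group_field_units)
  let ?A = "subgroup_generated field_units \<Gamma>"
  obtain c where c: "c \<noteq> 0" "\<And>d. d \<in> \<Gamma> \<Longrightarrow> \<exists>i j. i \<noteq> 0 \<and> d powi i = c powi j"
  proof (cases "\<exists>c\<in>\<Gamma>. \<forall>i. i \<noteq> 0 \<longrightarrow> c powi i \<noteq> 1")
    case True
    then obtain c where c: "c \<in> \<Gamma>" "\<And>i. i \<noteq> 0 \<Longrightarrow> c powi i \<noteq> 1" by blast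
    have "\<exists>i j. i \<noteq> 0 \<and> d powi i = c powi j" if d: "d \<in> \<Gamma>" for d
    proof -
      obtain i j where ij: "i \<noteq> 0 \<or> j \<noteq> 0" "c powi i * d powi j = 1" using dep[OF c(1) d] by blast
      then have "j \<noteq> 0" using c(2)[of i] by auto
      moreover have "c \<noteq> 0" using c(1) assms(2) by auto
      then have "d powi j = c powi (- i)" using ij(2) by (simp add: power_int_minus field_simps)
      ultimately show ?thesis by blast
    qed
    moreover have "c \<noteq> 0" using c(1) assms(2) by auto
    ultimately show thesis using that by blast
  next
    case False
    then have *: "\<exists>i j. i \<noteq> 0 \<and> d powi i = 1 powi j" if "d \<in> \<Gamma>" for d using that by fastforce
    show thesis by (rule that[of 1]) (simp, rule *)
  qed
  \<comment> \<open>The elements commensurable with a power of \<open>c\<close>.\<close>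
  define H where "H = {x. x \<noteq> 0 \<and> (\<exists>i j. i \<noteq> 0 \<and> x powi i = c powi j)}"
  have "subgroup H field_units"
  proof (rule U.subgroupI)
    show "H \<subseteq> carrier field_units" by (auto simp: H_def field_units_def)
    have "1 \<in> H" unfolding H_def by (intro CollectI conjI exI[of _ 1] exI[of _ 0]) auto
    then show "H \<noteq> {}" by blast
  next
    fix x assume "x \<in> H"
    then obtain i j where ij: "x \<noteq> 0" "i \<noteq> 0" "x powi i = c powi j" by (auto simp: H_def)
    then have "inverse x powi i = c powi (- j)" by (simp add: power_int_inverse power_int_minus)
    with ij show "inv\<^bsub>field_units\<^esub> x \<in> H" by (auto simp: H_def inv_field_units)
  next
    fix x y assume "x \<in> H" "y \<in> H"
    then obtain i j i' j' where ij: "x \<noteq> 0" "i \<noteq> 0" "x powi i = c powi j"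
      "y \<noteq> 0" "i' \<noteq> 0" "y powi i' = c powi j'" by (auto simp: H_def)
    have "(x * y) powi (i * i') = (x powi i) powi i' * (y powi i') powi i"
      using power_int_mult[of x i i'] power_int_mult[of y i' i]
      by (simp add: power_int_mult_distrib mult.commute)
    also have "\<dots> = c powi (j * i' + j' * i)"
      using c(1) by (simp add: ij power_int_add power_int_mult)
    finally have "(x * y) powi (i * i') = c powi (j * i' + j' * i)" .
    then have "x * y \<in> H"
      unfolding H_def mem_Collect_eq using ij
      by (intro conjI exI[of _ "i * i'"] exI[of _ "j * i' + j' * i"]; simp)
    then show "x \<otimes>\<^bsub>field_units\<^esub> y \<in> H" by (simp add: field_units_def)
  qed
  moreover have "\<Gamma> \<subseteq> H" using c(2) assms(2) by (auto simp: H_def)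
  ultimately have AH: "carrier ?A \<subseteq> H" by (rule U.subgroup_generated_minimal)
  obtain X where X: "int_independent ?A X" "1 < enat (card X)"
    using rank unfolding torsionfree_rank_def less_SUP_iff by blast
  then obtain x x' where x: "x \<in> X" "x' \<in> X" "x \<noteq> x'"
    by (metis card_le_Suc0_iff_eq int_independent_def enat_ord_simps(2) less_le_not_le not_less_eq_eq
        One_nat_def one_enat_def not_le)
  have carrier: "x \<in> carrier ?A" "x' \<in> carrier ?A" using X x by (auto simp: int_independent_def)
  have A: "comm_group ?A"
    by (rule U.abelian_subgroup_generated[OF comm_group_field_units])
  have ind: "i = 0 \<and> j = 0" if "x powi i * x' powi j = 1" for i j
  proof (rule int_independent_pair[OF A X(1) x])
    have "x \<noteq> 0" "x' \<noteq> 0" using AH carrier by (auto simp: H_def)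
    then show "x [^]\<^bsub>?A\<^esub> i \<otimes>\<^bsub>?A\<^esub> x' [^]\<^bsub>?A\<^esub> j = \<one>\<^bsub>?A\<^esub>"
      using that carrier
      by (simp add: U.int_pow_subgroup_generated int_pow_field_units) (simp add: field_units_def)
  qed
  obtain i j i' j' where ij: "i \<noteq> 0" "x powi i = c powi j" "i' \<noteq> 0" "x' powi i' = c powi j'"
    using subsetD[OF AH carrier(1)] subsetD[OF AH carrier(2)] unfolding H_def by blast
  have "x powi (i * j') * x' powi (- i' * j) = (x powi i) powi j' * inverse ((x' powi i') powi j)"
    by (simp add: power_int_mult power_int_minus)
  also have "\<dots> = 1" using c(1) power_int_mult[of c j j'] power_int_mult[of c j' j]
    by (simp add: ij mult.commute)
  finally have "j' = 0" using ind[of "i * j'" "- i' * j"] ij by simp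
  then show False using ind[of 0 i'] ij by simp
qed

section \<open>Linear maps on tensor squares\<close>

interpretation free: vector_space free_scale
  by (rule vector_space_free_scale)

lemma lin_ext_superset:
  assumes "vector_space s" "finite K" "Poly_Mapping.keys f \<subseteq> K"
  shows "lin_ext s \<phi> f = (\<Sum>x\<in>K. s (Poly_Mapping.lookup f x) (\<phi> x))"
proof -
  interpret vector_space s by fact
  show ?thesis
    unfolding lin_ext_def using assms
    by (intro sum.mono_neutral_left) (auto simp: in_keys_iff)
qed

lemma lin_ext_gen: "vector_space s \<Longrightarrow> lin_ext s \<phi> (gen x) = \<phi> x"
  by (simp add: lin_ext_def vector_space.vector_space_assms(4))

lemma lin_ext_linear:
  fixes \<phi> :: "'x \<Rightarrow> 'v::ab_group_add" and s :: "'k::field \<Rightarrow> 'v \<Rightarrow> 'v"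
  assumes "vector_space s"
  shows "Vector_Spaces.linear free_scale s (lin_ext s \<phi>)"
proof -
  interpret vector_space s by fact
  show ?thesis
  proof
    fix f g :: "'x \<Rightarrow>\<^sub>0 'k"
    let ?K = "Poly_Mapping.keys f \<union> Poly_Mapping.keys g \<union> Poly_Mapping.keys (f + g)"
    have "lin_ext s \<phi> h = (\<Sum>x\<in>?K. s (Poly_Mapping.lookup h x) (\<phi> x))"
      if "h \<in> {f, g, f + g}" for h
      using that by (intro lin_ext_superset[OF assms]) auto
    then show "lin_ext s \<phi> (f + g) = lin_ext s \<phi> f + lin_ext s \<phi> g"
      by (simp add: lookup_add scale_left_distrib sum.distrib)
  next
    fix c and f :: "'x \<Rightarrow>\<^sub>0 'k"
    have "lin_ext s \<phi> (free_scale c f) =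
        (\<Sum>x\<in>Poly_Mapping.keys f. s (Poly_Mapping.lookup (free_scale c f) x) (\<phi> x))"
      by (intro lin_ext_superset[OF assms])
        (auto simp: in_keys_iff lookup_free_scale)
    then show "lin_ext s \<phi> (free_scale c f) = s c (lin_ext s \<phi> f)"
      by (simp add: lin_ext_def lookup_free_scale scale_sum_right)
  qed
qed

lemmas lin_ext_add = Vector_Spaces.linear.axioms(3)[OF lin_ext_linear, THEN module_hom.add]
lemmas lin_ext_diff = Vector_Spaces.linear.axioms(3)[OF lin_ext_linear, THEN module_hom.diff]
lemmas lin_ext_scale = Vector_Spaces.linear.axioms(3)[OF lin_ext_linear, THEN module_hom.scale]
lemmas lin_ext_zero = Vector_Spaces.linear.axioms(3)[OF lin_ext_linear, THEN module_hom.zero]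

lemma linear_lin_ext:
  assumes "Vector_Spaces.linear s1 s2 L"
  shows "L (lin_ext s1 \<phi> f) = lin_ext s2 (\<lambda>x. L (\<phi> x)) f"
proof -
  interpret L: Vector_Spaces.linear s1 s2 L by fact
  show ?thesis by (simp add: lin_ext_def L.sum L.scale)
qed

lemma lin_ext_free_gen: "lin_ext free_scale gen f = f"
proof (rule poly_mapping_eqI)
  fix k
  have "Poly_Mapping.lookup (lin_ext free_scale gen f) k =
      (\<Sum>x\<in>Poly_Mapping.keys f. if k = x then Poly_Mapping.lookup f k else 0)"
    unfolding lin_ext_def lookup_sum
    by (rule sum.cong) (auto simp: lookup_free_scale lookup_single when_def)
  then show "Poly_Mapping.lookup (lin_ext free_scale gen f) k = Poly_Mapping.lookup f k"
    by (simp add: in_keys_iff)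
qed

lemma lin_ext_sum_list:
  assumes "vector_space s"
  shows "lin_ext s \<phi> (\<Sum>x\<leftarrow>xs. gen (F x)) = (\<Sum>x\<leftarrow>xs. \<phi> (F x))"
  by (induction xs) (simp_all add: lin_ext_zero[OF assms] lin_ext_add[OF assms] lin_ext_gen[OF assms])

lemma linear_span_subset:
  assumes L: "Vector_Spaces.linear s1 s2 L" and U: "module.subspace s2 U"
    and S: "\<And>x. x \<in> S \<Longrightarrow> L x \<in> U" and x: "x \<in> module.span s1 S"
  shows "L x \<in> U"
proof -
  interpret Vector_Spaces.linear s1 s2 L by fact
  show ?thesis
    using x by (rule vs1.span_induct) (use S subspace_vimage[OF U] in \<open>auto simp: vimage_def\<close>)
qed

context vector_space
begin

lemma subspace_rels: "free.subspace (bilinear_rels scale)"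
  unfolding bilinear_rels_def by (rule free.subspace_span)

text \<open>
  The way to leave the quotient \<open>H \<otimes> H\<close>: a linear map on formal sums that is bilinear modulo \<open>U\<close> descends
  to it.
\<close>

lemma bilinear_rels_image:
  assumes L: "Vector_Spaces.linear free_scale s L" and U: "module.subspace s U"
    and "\<And>a a' b. L (gen (a + a', b)) - (L (gen (a, b)) + L (gen (a', b))) \<in> U"
    and "\<And>a b b'. L (gen (a, b + b')) - (L (gen (a, b)) + L (gen (a, b'))) \<in> U"
    and "\<And>c a b. L (gen (scale c a, b)) - s c (L (gen (a, b))) \<in> U"
    and "\<And>c a b. L (gen (a, scale c b)) - s c (L (gen (a, b))) \<in> U"
    and f: "f \<in> bilinear_rels scale"
  shows "L f \<in> U"
proof -
  interpret L: Vector_Spaces.linear free_scale s L by fact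
  show ?thesis
    using f unfolding bilinear_rels_def
    by (rule linear_span_subset[OF L U, rotated])
      (use assms(3-6) in \<open>auto simp: L.add L.diff L.scale\<close>)
qed

lemma lin_ext_bilinear_rels:
  assumes s: "vector_space s"
    and \<beta>: "\<And>a a' b. \<beta> (a + a') b = \<beta> a b + \<beta> a' b" "\<And>a b b'. \<beta> a (b + b') = \<beta> a b + \<beta> a b'"
      "\<And>c a b. \<beta> (scale c a) b = s c (\<beta> a b)" "\<And>c a b. \<beta> a (scale c b) = s c (\<beta> a b)"
    and f: "f \<in> bilinear_rels scale"
  shows "lin_ext s (\<lambda>(a, b). \<beta> a b) f = 0"
proof -
  interpret s: vector_space s by fact
  have "lin_ext s (\<lambda>(a, b). \<beta> a b) f \<in> {0}"
    by (rule bilinear_rels_image[OF lin_ext_linear[OF s] _ _ _ _ _ f])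
      (simp_all add: s.subspace_single_0 lin_ext_gen[OF s] \<beta>)
  then show ?thesis by simp
qed

lemma rels_add_left: "gen (a + a', b) - (gen (a, b) + gen (a', b)) \<in> bilinear_rels scale"
  and rels_add_right: "gen (a, b + b') - (gen (a, b) + gen (a, b')) \<in> bilinear_rels scale"
  and rels_scale_left: "gen (scale c a, b) - free_scale c (gen (a, b)) \<in> bilinear_rels scale"
  and rels_scale_right: "gen (a, scale c b) - free_scale c (gen (a, b)) \<in> bilinear_rels scale"
  unfolding bilinear_rels_def by (rule free.span_base; blast)+

text \<open>
  The map \<open>id \<otimes> id \<otimes> \<psi>\<close> from \<open>H \<otimes> H \<otimes> H\<close> to \<open>H \<otimes> H\<close> is well defined.
\<close>

lemma trilinear_rels_contract:
  assumes \<psi>: "Vector_Spaces.linear scale (*) \<psi>" and f: "f \<in> trilinear_rels scale"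
  shows "lin_ext free_scale (\<lambda>(a, b, d). free_scale (\<psi> d) (gen (a, b))) f \<in> bilinear_rels scale"
proof -
  interpret \<psi>: Vector_Spaces.linear scale "(*)" \<psi> by fact
  let ?L = "lin_ext free_scale (\<lambda>(a, b, d). free_scale (\<psi> d) (gen (a, b)))"
  have L: "Vector_Spaces.linear free_scale free_scale ?L"
    by (rule lin_ext_linear[OF vector_space_free_scale])
  interpret L: Vector_Spaces.linear free_scale free_scale ?L by (fact L)
  have Lgen: "?L (gen (a, b, d)) = free_scale (\<psi> d) (gen (a, b))" for a b d
    by (simp add: lin_ext_gen[OF vector_space_free_scale])
  note R = free.subspace_scale[OF subspace_rels]
  show ?thesis
    using f unfolding trilinear_rels_def
  proof (rule linear_span_subset[OF L subspace_rels, rotated], goal_cases)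
    case (1 x)
    have add_left: "free_scale (\<psi> d) (gen (a + a', b)) - (free_scale (\<psi> d) (gen (a, b)) + free_scale (\<psi> d) (gen (a', b))) \<in> bilinear_rels scale"
      for d a a' b
      using R[OF rels_add_left, of "\<psi> d" a a' b]
      by (simp add: free.scale_right_diff_distrib free.scale_right_distrib)
    have add_right: "free_scale (\<psi> d) (gen (a, b + b')) - (free_scale (\<psi> d) (gen (a, b)) + free_scale (\<psi> d) (gen (a, b'))) \<in> bilinear_rels scale"
      for d a b b'
      using R[OF rels_add_right, of "\<psi> d" a b b']
      by (simp add: free.scale_right_diff_distrib free.scale_right_distrib)
    have scale_left: "free_scale (\<psi> d) (gen (scale c a, b)) - free_scale (c * \<psi> d) (gen (a, b)) \<in> bilinear_rels scale"
      for d a b c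
      using R[OF rels_scale_left, of "\<psi> d" c a b]
      by (simp add: free.scale_right_diff_distrib free.scale_right_distrib mult.commute)
    have scale_right: "free_scale (\<psi> d) (gen (a, scale c b)) - free_scale (c * \<psi> d) (gen (a, b)) \<in> bilinear_rels scale"
      for d a b c
      using R[OF rels_scale_right, of "\<psi> d" a c b]
      by (simp add: free.scale_right_diff_distrib free.scale_right_distrib mult.commute)
    have "0 \<in> bilinear_rels scale" by (rule free.subspace_0[OF subspace_rels])
    with 1 show ?case
      by (auto simp: L.add L.diff L.scale Lgen add_left add_right scale_left scale_right \<psi>.add \<psi>.scale free.scale_left_distrib)
  qed
qed

end

section \<open>Group-like and skew primitive elements\<close>

lemma tensor_mult_gen_gen: "tensor_mult (gen (a, b)) (gen (c, d)) = gen (a * c, b * d)"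
  by (simp add: tensor_mult_def lin_ext_gen[OF vector_space_free_scale])

lemma tensor_mult_add_left: "tensor_mult (f + f') g = tensor_mult f g + tensor_mult f' g"
  unfolding tensor_mult_def by (rule lin_ext_add[OF vector_space_free_scale])

lemma tensor_mult_gen_left:
  "tensor_mult (gen (a, b)) g = lin_ext free_scale (\<lambda>(a', b'). gen (a * a', b * b')) g"
  by (simp add: tensor_mult_def lin_ext_gen[OF vector_space_free_scale])

lemma tensor_mult_gen_right:
  "tensor_mult f (gen (c, d)) = lin_ext free_scale (\<lambda>(a, b). gen (a * c, b * d)) f"
  by (simp add: tensor_mult_def lin_ext_gen[OF vector_space_free_scale] case_prod_unfold)

context hopf_algebra
begin

abbreviation "GL \<equiv> group_likes scale \<Delta>"
abbreviation "C0 \<equiv> group_like_span scale \<Delta>"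
abbreviation "functional \<psi> \<equiv> Vector_Spaces.linear scale (*) \<psi>"

sublocale counit: Vector_Spaces.linear scale "(*)" \<epsilon> by (rule counit_linear)

lemma comul_nonempty: "\<exists>f. f \<in> \<Delta> x"
proof -
  obtain f where "\<Delta> x = tensor2 scale f" using comul_tensor by blast
  then have "f \<in> \<Delta> x" using free.subspace_0[OF subspace_rels] by (simp add: tensor2_def)
  then show ?thesis by blast
qed

lemma comul_eq_tensor2_iff: "\<Delta> x = tensor2 scale f \<longleftrightarrow> f \<in> \<Delta> x"
proof -
  obtain f0 where f0: "\<Delta> x = tensor2 scale f0" using comul_tensor by blast
  have "tensor2 scale f0 = tensor2 scale f" if f: "f - f0 \<in> bilinear_rels scale"
  proof -
    have "g - f0 \<in> bilinear_rels scale \<longleftrightarrow> g - f \<in> bilinear_rels scale" for g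
      using free.subspace_diff[OF subspace_rels _ f, of "g - f0"]
        free.subspace_add[OF subspace_rels _ f, of "g - f"] by auto
    then show ?thesis by (simp add: tensor2_def)
  qed
  moreover have "f \<in> tensor2 scale f" using free.subspace_0[OF subspace_rels] by (simp add: tensor2_def)
  moreover have "f \<in> tensor2 scale f0 \<longleftrightarrow> f - f0 \<in> bilinear_rels scale" by (simp add: tensor2_def)
  ultimately show ?thesis unfolding f0 by metis
qed

lemma comul_rep_diff: "f \<in> \<Delta> x \<Longrightarrow> g \<in> \<Delta> x \<Longrightarrow> f - g \<in> bilinear_rels scale"
  using comul_eq_tensor2_iff[of x g] by (auto simp: tensor2_def)

lemma comul_rep_cong: "f \<in> \<Delta> x \<Longrightarrow> g - f \<in> bilinear_rels scale \<Longrightarrow> g \<in> \<Delta> x"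
  using comul_eq_tensor2_iff[of x f] by (auto simp: tensor2_def)

text \<open>
  The map \<open>(\<phi> \<otimes> id) \<Delta>\<close>; by bilinearity the choice of the representative does not matter.
\<close>

definition slice_left :: "('h \<Rightarrow> 'k) \<Rightarrow> 'h \<Rightarrow> 'h" where
  "slice_left \<phi> x = lin_ext scale (\<lambda>(a, b). scale (\<phi> a) b) (SOME f. f \<in> \<Delta> x)"

text \<open>
  The map \<open>(id \<otimes> \<psi>) \<Delta>\<close>.
\<close>

definition slice_right :: "('h \<Rightarrow> 'k) \<Rightarrow> 'h \<Rightarrow> 'h" where
  "slice_right \<psi> x = lin_ext scale (\<lambda>(a, b). scale (\<psi> b) a) (SOME f. f \<in> \<Delta> x)"

lemma slice_left_eq:
  assumes \<phi>: "functional \<phi>" and f: "f \<in> \<Delta> x"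
  shows "slice_left \<phi> x = lin_ext scale (\<lambda>(a, b). scale (\<phi> a) b) f"
proof -
  interpret \<phi>: Vector_Spaces.linear scale "(*)" \<phi> by fact
  let ?g = "SOME f. f \<in> \<Delta> x"
  have "?g \<in> \<Delta> x" by (rule someI_ex[OF comul_nonempty])
  from comul_rep_diff[OF this f] have "lin_ext scale (\<lambda>(a, b). scale (\<phi> a) b) (?g - f) = 0"
    by (rule lin_ext_bilinear_rels[OF vector_space_axioms, rotated -1])
      (simp_all add: \<phi>.add \<phi>.scale algebra_simps)
  then show ?thesis by (simp add: slice_left_def lin_ext_diff[OF vector_space_axioms])
qed

lemma slice_right_eq:
  assumes \<psi>: "functional \<psi>" and f: "f \<in> \<Delta> x"
  shows "slice_right \<psi> x = lin_ext scale (\<lambda>(a, b). scale (\<psi> b) a) f"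
proof -
  interpret \<psi>: Vector_Spaces.linear scale "(*)" \<psi> by fact
  let ?g = "SOME f. f \<in> \<Delta> x"
  have "?g \<in> \<Delta> x" by (rule someI_ex[OF comul_nonempty])
  from comul_rep_diff[OF this f] have "lin_ext scale (\<lambda>(a, b). scale (\<psi> b) a) (?g - f) = 0"
    by (rule lin_ext_bilinear_rels[OF vector_space_axioms, rotated -1])
      (simp_all add: \<psi>.add \<psi>.scale algebra_simps)
  then show ?thesis by (simp add: slice_right_def lin_ext_diff[OF vector_space_axioms])
qed

lemma slice_left_linear:
  assumes "functional \<phi>" shows "Vector_Spaces.linear scale scale (slice_left \<phi>)"
proof
  fix x y
  obtain f g where "f \<in> \<Delta> x" "g \<in> \<Delta> y" using comul_nonempty by meson
  then show "slice_left \<phi> (x + y) = slice_left \<phi> x + slice_left \<phi> y"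
    using slice_left_eq[OF assms comul_add] slice_left_eq[OF assms]
    by (simp add: lin_ext_add[OF vector_space_axioms])
next
  fix c x
  obtain f where "f \<in> \<Delta> x" using comul_nonempty by meson
  then show "slice_left \<phi> (scale c x) = scale c (slice_left \<phi> x)"
    using slice_left_eq[OF assms comul_scale] slice_left_eq[OF assms]
    by (simp add: lin_ext_scale[OF vector_space_axioms])
qed

lemma slice_right_linear:
  assumes "functional \<psi>" shows "Vector_Spaces.linear scale scale (slice_right \<psi>)"
proof
  fix x y
  obtain f g where "f \<in> \<Delta> x" "g \<in> \<Delta> y" using comul_nonempty by meson
  then show "slice_right \<psi> (x + y) = slice_right \<psi> x + slice_right \<psi> y"
    using slice_right_eq[OF assms comul_add] slice_right_eq[OF assms]
    by (simp add: lin_ext_add[OF vector_space_axioms])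
next
  fix c x
  obtain f where "f \<in> \<Delta> x" using comul_nonempty by meson
  then show "slice_right \<psi> (scale c x) = scale c (slice_right \<psi> x)"
    using slice_right_eq[OF assms comul_scale] slice_right_eq[OF assms]
    by (simp add: lin_ext_scale[OF vector_space_axioms])
qed

lemma one_neq_0: "(1::'h) \<noteq> 0"
  using counit_one counit.zero by auto

lemma group_like_iff: "g \<in> GL \<longleftrightarrow> g \<noteq> 0 \<and> gen (g, g) \<in> \<Delta> g"
  by (simp add: group_likes_def comul_eq_tensor2_iff)

lemma slice_right_group_like:
  "functional \<psi> \<Longrightarrow> g \<in> GL \<Longrightarrow> slice_right \<psi> g = scale (\<psi> g) g"
  by (subst slice_right_eq) (auto simp: group_like_iff lin_ext_gen[OF vector_space_axioms])

lemma slice_left_group_like: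
  "functional \<psi> \<Longrightarrow> g \<in> GL \<Longrightarrow> slice_left \<psi> g = scale (\<psi> g) g"
  by (subst slice_left_eq) (auto simp: group_like_iff lin_ext_gen[OF vector_space_axioms])

lemma counit_group_like: assumes "g \<in> GL" shows "\<epsilon> g = 1"
proof -
  have "scale (\<epsilon> g) g = g"
    using counit_left[of "gen (g, g)" g] assms
    by (simp add: group_like_iff lin_ext_gen[OF vector_space_axioms])
  then have "scale (\<epsilon> g - 1) g = 0" by (simp add: scale_left_diff_distrib)
  then show ?thesis using assms by (simp add: group_like_iff)
qed

lemma group_like_one: "1 \<in> GL"
  using comul_eq_tensor2_iff[of 1 "gen (1, 1)"] comul_one one_neq_0 by (simp add: group_like_iff)

lemma group_like_mult:
  assumes "g \<in> GL" "h \<in> GL" shows "g * h \<in> GL"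
proof -
  have "\<epsilon> (g * h) = 1" using assms by (simp add: counit_mult counit_group_like)
  then have "g * h \<noteq> 0" using counit.zero by auto
  moreover have "gen (g * h, g * h) \<in> \<Delta> (g * h)"
    using comul_mult[of "gen (g, g)" g "gen (h, h)" h] assms
    by (simp add: group_like_iff tensor_mult_gen_gen)
  ultimately show ?thesis by (simp add: group_like_iff)
qed

lemma rels_mult_right:
  assumes "f \<in> bilinear_rels scale"
  shows "tensor_mult f (gen (c, d)) \<in> bilinear_rels scale"
  unfolding tensor_mult_gen_right
  by (rule bilinear_rels_image[OF lin_ext_linear[OF vector_space_free_scale] subspace_rels _ _ _ _ assms])
    (simp_all add: lin_ext_gen[OF vector_space_free_scale] distrib_right rels_add_left
      rels_add_right scale_mult_left rels_scale_left rels_scale_right)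

text \<open>
  The element \<open>\<Delta>(S g)\<close> is inverse to \<open>\<Delta>(g) = g \<otimes> g\<close>, hence equal to \<open>S g \<otimes> S g\<close>.
\<close>

lemma group_like_inverse:
  assumes g: "g \<in> GL"
  shows "S g \<in> GL" "S g * g = 1" "g * S g = 1"
proof -
  have gg: "gen (g, g) \<in> \<Delta> g" using g by (simp add: group_like_iff)
  show 1: "S g * g = 1" "g * S g = 1"
    using antipode_left[OF gg] antipode_right[OF gg] counit_group_like[OF g]
    by (simp_all add: lin_ext_gen[OF vector_space_axioms])
  obtain f where f: "f \<in> \<Delta> (S g)" using comul_nonempty by blast
  have "tensor_mult f (gen (g, g)) - gen (1, 1) \<in> bilinear_rels scale"
    using comul_mult[OF f gg] comul_one by (simp add: 1 tensor2_def)
  then have "tensor_mult (tensor_mult f (gen (g, g)) - gen (1, 1)) (gen (S g, S g)) \<in> bilinear_rels scale"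
    by (rule rels_mult_right)
  moreover have "tensor_mult (tensor_mult f (gen (g, g)) - gen (1, 1)) (gen (S g, S g)) = f - gen (S g, S g)"
  proof -
    have "lin_ext free_scale (\<lambda>(a, b). gen (a * S g, b * S g))
       (lin_ext free_scale (\<lambda>(a, b). gen (a * g, b * g)) f) = f"
      by (simp add: linear_lin_ext[OF lin_ext_linear[OF vector_space_free_scale]] case_prod_unfold
        lin_ext_gen[OF vector_space_free_scale] mult.assoc 1 lin_ext_free_gen)
    then show ?thesis
      unfolding tensor_mult_gen_right lin_ext_diff[OF vector_space_free_scale]
      by (simp add: lin_ext_gen[OF vector_space_free_scale])
  qed
  ultimately have "gen (S g, S g) - f \<in> bilinear_rels scale"
    using free.subspace_neg[OF subspace_rels] by fastforce
  then have "gen (S g, S g) \<in> \<Delta> (S g)" using f comul_rep_cong by blast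
  moreover have "S g \<noteq> 0" using 1 one_neq_0 by auto
  ultimately show "S g \<in> GL" by (simp add: group_like_iff)
qed

lemma group_group_like: "group (group_like_group scale \<Delta>)"
  by (rule groupI)
    (auto simp: group_like_group_def group_like_mult group_like_one mult.assoc
      intro: group_like_inverse)

lemma inv_group_like: "g \<in> GL \<Longrightarrow> inv\<^bsub>group_like_group scale \<Delta>\<^esub> g = S g"
  by (rule group.inv_equality[OF group_group_like])
    (simp_all add: group_like_group_def group_like_inverse)

text \<open>
  Given a relation between \<open>g\<close> and independent group-like elements \<open>F\<close>, let \<open>\<phi>\<close> be dual to \<open>h \<in> F\<close>.
  Applying \<open>\<phi>\<close> and \<open>\<phi> \<otimes> id\<close> to the relation gives \<open>a(h) (h - g) = 0\<close>.
\<close>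

lemma independent_group_likes: "independent_family scale (\<lambda>g. g) GL"
proof -
  have fin: "independent_family scale (\<lambda>g. g) F" if "finite F" "F \<subseteq> GL" for F
    using that
  proof (induction F)
    case empty
    then show ?case by (simp add: independent_family_def)
  next
    case (insert g F)
    show ?case
      unfolding independent_family_def
    proof (intro allI impI)
      fix A and b :: "'h \<Rightarrow> 'k"
      assume A: "finite A" "A \<subseteq> insert g F" "(\<Sum>i\<in>A. scale (b i) i) = 0"
      define a where "a i = (if i \<in> A then b i else 0)" for i
      have "(\<Sum>i\<in>insert g F. scale (a i) i) = (\<Sum>i\<in>A. scale (b i) i)"
        using A insert.hyps by (intro sum.mono_neutral_cong_right) (auto simp: a_def)
      then have rel: "scale (a g) g + (\<Sum>i\<in>F. scale (a i) i) = 0"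
        using A insert.hyps by simp
      have aF: "a h = 0" if h: "h \<in> F" for h
      proof -
        obtain \<phi> where \<phi>: "functional \<phi>" "\<And>j. j \<in> F \<Longrightarrow> \<phi> j = (if j = h then 1 else 0)"
          using dual_functional[OF insert.IH h] insert.prems by blast
        interpret \<phi>: Vector_Spaces.linear scale "(*)" \<phi> by (fact \<phi>(1))
        interpret sl: Vector_Spaces.linear scale scale "slice_left \<phi>"
          by (rule slice_left_linear[OF \<phi>(1)])
        have F: "(\<Sum>i\<in>F. if i = h then c i else 0) = c h" for c :: "'h \<Rightarrow> 'x::comm_monoid_add"
          using h insert.hyps by (simp add: sum.delta)
        have "0 = \<phi> (scale (a g) g + (\<Sum>i\<in>F. scale (a i) i))" by (simp add: rel \<phi>.zero)
        also have "\<dots> = a g * \<phi> g + (\<Sum>i\<in>F. if i = h then a i else 0)"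
          by (simp add: \<phi>.add \<phi>.sum \<phi>.scale) (intro sum.cong, auto simp: \<phi>(2))
        finally have 1: "a g * \<phi> g = - a h" unfolding F by (simp add: eq_neg_iff_add_eq_0)
        have "0 = slice_left \<phi> (scale (a g) g + (\<Sum>i\<in>F. scale (a i) i))" by (simp add: rel sl.zero)
        also have "\<dots> = scale (a g * \<phi> g) g + (\<Sum>i\<in>F. scale (a i) (scale (\<phi> i) i))"
          using insert.prems
          by (simp add: sl.add sl.sum sl.scale slice_left_group_like[OF \<phi>(1)] subset_iff)
        also have "(\<Sum>i\<in>F. scale (a i) (scale (\<phi> i) i)) = (\<Sum>i\<in>F. if i = h then scale (a i) i else 0)"
          by (intro sum.cong) (auto simp: \<phi>(2))
        finally have "scale (a h) (h - g) = 0"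
          unfolding F 1 by (simp add: scale_right_diff_distrib)
        then show ?thesis using h insert.hyps by auto
      qed
      then have "scale (a g) g = 0" using rel by simp
      then have "a g = 0" using insert.prems by (simp add: group_like_iff)
      with aF have "a i = 0" if "i \<in> insert g F" for i using that by auto
      with A(2) show "\<forall>i\<in>A. b i = 0" by (metis a_def subsetD)
    qed
  qed
  show ?thesis
    unfolding independent_family_def
    using fin unfolding independent_family_def by (meson subset_refl)
qed

definition primitive_of_weight :: "'h \<Rightarrow> 'h \<Rightarrow> bool" where
  "primitive_of_weight g y \<longleftrightarrow> gen (y, 1) + gen (g, y) \<in> \<Delta> y"

lemma has_weight_iff: "has_weight scale \<Delta> y g \<longleftrightarrow> y \<noteq> 0 \<and> primitive_of_weight g y"
  by (simp add: has_weight_def primitive_of_weight_def comul_eq_tensor2_iff)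

lemma slice_right_primitive:
  "functional \<psi> \<Longrightarrow> primitive_of_weight g y \<Longrightarrow> slice_right \<psi> y = scale (\<psi> 1) y + scale (\<psi> y) g"
  unfolding primitive_of_weight_def
  by (subst slice_right_eq)
    (auto simp: lin_ext_gen[OF vector_space_axioms] lin_ext_add[OF vector_space_axioms])

lemma slice_left_primitive:
  "functional \<phi> \<Longrightarrow> primitive_of_weight g y \<Longrightarrow> slice_left \<phi> y = scale (\<phi> y) 1 + scale (\<phi> g) y"
  unfolding primitive_of_weight_def
  by (subst slice_left_eq)
    (auto simp: lin_ext_gen[OF vector_space_axioms] lin_ext_add[OF vector_space_axioms])

lemma weight_eq:
  assumes "y \<noteq> 0" "primitive_of_weight g y"
  shows "weight scale \<Delta> y = g"
proof -
  have "g' = g" if "primitive_of_weight g' y" for g'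
  proof -
    obtain \<psi> where \<psi>: "functional \<psi>" "\<psi> y = 1"
      using functional_separating[of y "{}"] assms(1) by auto
    show ?thesis
      using slice_right_primitive[OF \<psi>(1) assms(2)] slice_right_primitive[OF \<psi>(1) that] \<psi>(2)
      by simp
  qed
  then show ?thesis
    unfolding weight_def has_weight_iff using assms by (intro the_equality) blast+
qed

text \<open>
  Compare the two sides of coassociativity at \<open>y\<close>: what remains is \<open>(\<Delta>(g) - g \<otimes> g) \<otimes> y = 0\<close>. If \<open>g\<close> were 0,
  the counit would make \<open>y\<close> a scalar.
\<close>

lemma weight_group_like:
  assumes y: "primitive_of_weight g y" and "y \<notin> C0"
  shows "g \<in> GL"
proof -
  have 1: "1 \<in> C0" unfolding group_like_span_def by (rule span_base[OF group_like_one])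
  have 0: "0 \<in> C0" unfolding group_like_span_def by (rule span_zero)
  have "y \<noteq> 1" "y \<noteq> 0" using 0 1 assms(2) by auto
  obtain \<psi> where \<psi>: "functional \<psi>" "\<psi> y = 1"
    using functional_separating[of y "{}"] \<open>y \<noteq> 0\<close> by auto
  define f where "f = gen (y, 1) + (gen (g, y) :: 'h \<times> 'h \<Rightarrow>\<^sub>0 'k)"
  \<comment> \<open>Representatives of \<open>\<Delta>\<close> that make both sides of coassociativity explicit.\<close>
  define D where "D a = (if a = y then f else if a = 1 then gen (1, 1) else (SOME f. f \<in> \<Delta> a))" for a
  have f: "f \<in> \<Delta> y" using y by (simp add: f_def primitive_of_weight_def)
  have one: "gen (1, 1) \<in> \<Delta> 1" using group_like_one by (simp add: group_like_iff)
  have D: "D a \<in> \<Delta> a" for a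
    using f one someI_ex[OF comul_nonempty, of a] by (auto simp: D_def)
  have Dy: "D y = f" and D1: "D 1 = gen (1, 1)" using \<open>y \<noteq> 1\<close> by (auto simp: D_def)
  note ext = lin_ext_gen[OF vector_space_free_scale] lin_ext_add[OF vector_space_free_scale]
    lin_ext_diff[OF vector_space_free_scale]
  let ?l = "lin_ext free_scale (\<lambda>(a, b). lin_ext free_scale (\<lambda>(u, v). gen (u, v, b)) (D a)) f"
  let ?r = "lin_ext free_scale (\<lambda>(a, b). lin_ext free_scale (\<lambda>(u, v). gen (a, u, v)) (D b)) f"
  have "tensor3 scale ?l = tensor3 scale ?r" by (rule comul_coassoc[OF f D])
  moreover have "?l \<in> tensor3 scale ?l"
    using free.span_zero by (simp add: tensor3_def trilinear_rels_def)
  ultimately have "?l - ?r \<in> trilinear_rels scale" by (simp add: tensor3_def)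
  moreover have "?l = gen (y, 1, 1) + gen (g, y, 1) + lin_ext free_scale (\<lambda>(u, v). gen (u, v, y)) (D g)"
    by (subst f_def, simp add: ext Dy) (simp add: f_def ext)
  moreover have "?r = gen (y, 1, 1) + (gen (g, y, 1) + gen (g, g, y))"
    by (subst f_def, simp add: ext Dy D1) (simp add: f_def ext)
  ultimately have "lin_ext free_scale (\<lambda>(u, v). gen (u, v, y)) (D g) - gen (g, g, y) \<in> trilinear_rels scale"
    by (simp add: algebra_simps)
  from trilinear_rels_contract[OF \<psi>(1) this] have "D g - gen (g, g) \<in> bilinear_rels scale"
    by (simp add: ext linear_lin_ext[OF lin_ext_linear[OF vector_space_free_scale]] case_prod_unfold
        \<psi>(2) lin_ext_free_gen)
  then have "gen (g, g) - D g \<in> bilinear_rels scale"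
    using free.subspace_neg[OF subspace_rels] by fastforce
  then have "gen (g, g) \<in> \<Delta> g" using D comul_rep_cong by blast
  moreover have "g \<noteq> 0"
  proof
    assume "g = 0"
    have "scale (\<epsilon> y) 1 + scale (\<epsilon> g) y = y"
      using counit_left[OF f] by (simp add: f_def lin_ext_gen[OF vector_space_axioms] lin_ext_add[OF vector_space_axioms])
    then have "y = scale (\<epsilon> y) 1" using \<open>g = 0\<close> counit.zero by simp
    then show False using 1 assms(2) span_scale unfolding group_like_span_def by metis
  qed
  ultimately show ?thesis by (simp add: group_like_iff)
qed

lemma primitive_add:
  assumes "primitive_of_weight g y" "primitive_of_weight g z"
  shows "primitive_of_weight g (y + z)"
  unfolding primitive_of_weight_def
proof (rule comul_rep_cong)
  show "(gen (y, 1) + gen (g, y)) + (gen (z, 1) + gen (g, z)) \<in> \<Delta> (y + z)"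
    using assms comul_add by (simp add: primitive_of_weight_def)
  show "gen (y + z, 1) + gen (g, y + z) - ((gen (y, 1) + gen (g, y)) + (gen (z, 1) + gen (g, z)))
      \<in> bilinear_rels scale"
    using free.subspace_add[OF subspace_rels rels_add_left[of y z 1] rels_add_right[of g y z]]
    by (simp add: algebra_simps)
qed

lemma primitive_scale:
  assumes "primitive_of_weight g y"
  shows "primitive_of_weight g (scale c y)"
  unfolding primitive_of_weight_def
proof (rule comul_rep_cong)
  show "free_scale c (gen (y, 1) + gen (g, y)) \<in> \<Delta> (scale c y)"
    using assms comul_scale by (simp add: primitive_of_weight_def)
  show "gen (scale c y, 1) + gen (g, scale c y) - free_scale c (gen (y, 1) + gen (g, y)) \<in> bilinear_rels scale"
    using free.subspace_add[OF subspace_rels rels_scale_left[of c y 1] rels_scale_right[of g c y]]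
    by (simp add: free.scale_right_distrib algebra_simps)
qed

lemma primitive_conj:
  assumes "primitive_of_weight g y" and h: "h \<in> GL" and comm: "g * h = h * g"
  shows "primitive_of_weight g (S h * y * h)"
proof -
  have "gen (S h, S h) \<in> \<Delta> (S h)" "gen (h, h) \<in> \<Delta> h"
    using h group_like_inverse(1)[OF h] by (auto simp: group_like_iff)
  with assms(1) have "tensor_mult (tensor_mult (gen (S h, S h)) (gen (y, 1) + gen (g, y))) (gen (h, h))
      \<in> \<Delta> (S h * y * h)"
    unfolding primitive_of_weight_def by (intro comul_mult)
  moreover have "S h * g * h = g"
    using comm group_like_inverse(2)[OF h] by (metis mult.assoc mult_1)
  ultimately show ?thesis
    unfolding primitive_of_weight_def tensor_mult_gen_left tensor_mult_gen_right
    by (simp add: lin_ext_gen[OF vector_space_free_scale] lin_ext_add[OF vector_space_free_scale]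
        group_like_inverse(2)[OF h])
qed

text \<open>
  Let \<open>\<phi>\<close> be 1 on the unit and 0 on the other group-like elements. On the span of the group-likes
  \<open>(id \<otimes> \<phi>) \<Delta>\<close> is \<open>z \<mapsto> \<phi>(z) 1\<close>, while the primitivity of \<open>z\<close> gives \<open>z + \<phi>(z) g\<close>.
\<close>

lemma trivial_primitive:
  assumes "primitive_of_weight g z" "z \<in> C0"
  obtains c where "z = scale c (1 - g)"
proof -
  obtain \<phi> where \<phi>: "functional \<phi>" "\<And>h. h \<in> GL \<Longrightarrow> \<phi> h = (if h = 1 then 1 else 0)"
    using dual_functional[OF independent_group_likes group_like_one] by blast
  interpret \<phi>: Vector_Spaces.linear scale "(*)" \<phi> by (fact \<phi>(1))
  interpret sr: Vector_Spaces.linear scale scale "slice_right \<phi>"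
    by (rule slice_right_linear[OF \<phi>(1)])
  have "z \<in> span GL" using assms(2) by (simp add: group_like_span_def)
  then have "slice_right \<phi> z = scale (\<phi> z) 1"
  proof (induction rule: span_induct_alt)
    case base
    then show ?case by (simp add: sr.zero \<phi>.zero)
  next
    case (step c x y)
    then show ?case
      by (simp add: sr.add sr.scale \<phi>.add \<phi>.scale slice_right_group_like[OF \<phi>(1)] \<phi>(2)
          scale_left_distrib)
  qed
  with slice_right_primitive[OF \<phi>(1) assms(1)] \<phi>(2)[OF group_like_one]
  have "z = scale (\<phi> z) (1 - g)" by (simp add: scale_right_diff_distrib algebra_simps)
  then show thesis by (rule that)
qed

end

section \<open>Skew primitive elements as eigenvectors of conjugation\<close>

context hopf_algebra
begin

lemma primitive_subspace: "subspace {y. primitive_of_weight g y}"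
proof (rule subspaceI)
  obtain f where "f \<in> \<Delta> 1" using comul_nonempty by blast
  have "free_scale 0 f \<in> \<Delta> (scale 0 1)" by (rule comul_scale) fact
  then have "0 \<in> \<Delta> 0" by simp
  moreover have "gen (0, 1) + gen (g, 0) - 0 \<in> bilinear_rels scale"
    using free.subspace_add[OF subspace_rels rels_scale_left[of 0 0 1] rels_scale_right[of g 0 0]]
    by simp
  ultimately show "0 \<in> {y. primitive_of_weight g y}"
    unfolding primitive_of_weight_def mem_Collect_eq by (rule comul_rep_cong)
qed (auto intro: primitive_add primitive_scale)

lemma group_like_span_subspace: "subspace C0"
  unfolding group_like_span_def by (rule subspace_span)

lemma group_like_span_mult_left:
  assumes "h \<in> GL" "x \<in> C0" shows "h * x \<in> C0"
proof -
  have "x \<in> span GL" using assms(2) by (simp add: group_like_span_def)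
  then have "h * x \<in> span GL"
  proof (induction rule: span_induct_alt)
    case base
    then show ?case by (simp add: span_zero)
  next
    case (step c x y)
    then show ?case
      using assms(1)
      by (simp add: distrib_left scale_mult_right span_add span_scale span_base group_like_mult)
  qed
  then show ?thesis by (simp add: group_like_span_def)
qed

lemma group_like_span_mult_right:
  assumes "h \<in> GL" "x \<in> C0" shows "x * h \<in> C0"
proof -
  have "x \<in> span GL" using assms(2) by (simp add: group_like_span_def)
  then have "x * h \<in> span GL"
  proof (induction rule: span_induct_alt)
    case base
    then show ?case by (simp add: span_zero)
  next
    case (step c x y)
    then show ?case
      using assms(1)
      by (simp add: distrib_right scale_mult_left span_add span_scale span_base group_like_mult)
  qed
  then show ?thesis by (simp add: group_like_span_def)
qed

lemma slice_left_group_like_span: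
  assumes "functional \<phi>" "x \<in> C0" shows "slice_left \<phi> x \<in> C0"
proof -
  interpret sl: Vector_Spaces.linear scale scale "slice_left \<phi>"
    by (rule slice_left_linear[OF assms(1)])
  have "x \<in> span GL" using assms(2) by (simp add: group_like_span_def)
  then have "slice_left \<phi> x \<in> span GL"
  proof (induction rule: span_induct_alt)
    case base
    then show ?case by (simp add: span_zero sl.zero)
  next
    case (step c x y)
    then show ?case
      by (simp add: sl.add sl.scale slice_left_group_like[OF assms(1)] span_add span_scale span_base)
  qed
  then show ?thesis by (simp add: group_like_span_def)
qed

lemma trivial_primitive_commutes:
  assumes "primitive_of_weight g z" "z \<in> C0" shows "z * g = g * z"
proof -
  obtain c where "z = scale c (1 - g)" using trivial_primitive[OF assms] .
  then show ?thesis
    by (simp add: scale_mult_left scale_mult_right left_diff_distrib right_diff_distrib)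
qed

text \<open>
  A skew primitive element in the span of the group-likes commutes with its weight, so conjugation
  by the weight fixes it.
\<close>

lemma trivial_eigenvector_eq_0:
  assumes g: "g \<in> GL" and v: "primitive_of_weight g v" "v \<in> C0" "v * g = scale c (g * v)" and "c \<noteq> 1"
  shows "v = 0"
proof -
  have "scale (1 - c) (g * v) = 0"
    using v(3) trivial_primitive_commutes[OF v(1,2)] by (simp add: scale_left_diff_distrib)
  then have "S g * (g * v) = 0" using \<open>c \<noteq> 1\<close> by simp
  then show ?thesis by (simp add: group_like_inverse[OF g] flip: mult.assoc)
qed

text \<open>
  The error term \<open>z\<close> is itself skew primitive of weight \<open>g\<close> and commutes with \<open>g\<close>, so a multiple
  of it corrects \<open>y\<close> because \<open>c \<noteq> 1\<close>.
\<close>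

lemma exact_eigenvector:
  assumes g: "g \<in> GL" and y: "primitive_of_weight g y" "y \<notin> C0"
    and c: "S g * y * g - scale c y \<in> C0" "c \<noteq> 1"
  obtains v where "primitive_of_weight g v" "v \<notin> C0" "v * g = scale c (g * v)"
proof
  define z where "z = S g * y * g - scale c y"
  \<comment> \<open>The solution of \<open>1 + t = c t\<close>, which makes \<open>y + t z\<close> an eigenvector.\<close>
  define t where "t = 1 / (c - 1)"
  have z: "primitive_of_weight g z"
    using primitive_conj[OF y(1) g refl] subspace_diff[OF primitive_subspace] primitive_scale[OF y(1)]
    unfolding z_def by blast
  have "z * g = g * z" using trivial_primitive_commutes[OF z] c(1) by (simp add: z_def)
  have "y * g = g * z + scale c (g * y)"
    unfolding z_def by (simp add: right_diff_distrib scale_mult_right group_like_inverse[OF g] flip: mult.assoc)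
  then have "(y + scale t z) * g = scale (1 + t) (g * z) + scale c (g * y)"
    by (simp add: distrib_right scale_mult_left scale_left_distrib \<open>z * g = g * z\<close>)
  also have "1 + t = c * t" using c(2) by (simp add: t_def field_simps)
  also have "scale (c * t) (g * z) + scale c (g * y) = scale c (g * (y + scale t z))"
    by (simp add: distrib_left scale_mult_right scale_right_distrib)
  finally show "(y + scale t z) * g = scale c (g * (y + scale t z))" .
  show "primitive_of_weight g (y + scale t z)"
    by (intro primitive_add primitive_scale y z)
  show "y + scale t z \<notin> C0"
    using y(2) c(1) subspace_diff[OF group_like_span_subspace, of "y + scale t z" "scale t z"]
      subspace_scale[OF group_like_span_subspace, of z t] by (auto simp: z_def)
qed

abbreviation "GG \<equiv> group_like_group scale \<Delta>"

lemma eigenvector_int_pow: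
  assumes g: "g \<in> GL" and y: "y * g = scale c (g * y)" and "c \<noteq> 0"
  shows "y * (g [^]\<^bsub>GG\<^esub> (i::int)) = scale (c powi i) (g [^]\<^bsub>GG\<^esub> i * y)"
proof -
  interpret GG: group GG by (rule group_group_like)
  have nat_mem: "g [^]\<^bsub>GG\<^esub> n \<in> GL" for n :: nat
    using GG.nat_pow_closed[of g n] g by (simp add: group_like_group_def)
  have nat: "y * (g [^]\<^bsub>GG\<^esub> n) = scale (c ^ n) (g [^]\<^bsub>GG\<^esub> n * y)" for n :: nat
  proof (induction n)
    case (Suc n)
    have "y * (g [^]\<^bsub>GG\<^esub> Suc n) = y * (g [^]\<^bsub>GG\<^esub> n) * g"
      by (simp add: group_like_group_def mult.assoc)
    also have "\<dots> = scale (c ^ n * c) (g [^]\<^bsub>GG\<^esub> n * g * y)"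
      by (simp add: Suc scale_mult_left mult.assoc y scale_mult_right)
    finally show ?case by (simp add: group_like_group_def mult.commute)
  qed (simp add: group_like_group_def)
  show ?thesis
  proof (cases "i < 0")
    case False
    then have "g [^]\<^bsub>GG\<^esub> i = g [^]\<^bsub>GG\<^esub> nat i" "c powi i = c ^ nat i"
      by (simp_all add: int_pow_def2 power_int_def del: pow_nat)
    then show ?thesis using nat[of "nat i"] by (simp only:)
  next
    case True
    define n where "n = nat (- i)"
    define h where "h = g [^]\<^bsub>GG\<^esub> n"
    have h: "h \<in> GL" unfolding h_def by (rule nat_mem)
    note inv = group_like_inverse(2,3)[OF h]
    have "S h * y = S h * (y * h) * S h" by (simp add: mult.assoc inv)
    also have "y * h = scale (c ^ n) (h * y)" unfolding h_def by (rule nat)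
    also have "S h * scale (c ^ n) (h * y) * S h = scale (c ^ n) (S h * h * y * S h)"
      by (simp add: scale_mult_left scale_mult_right mult.assoc)
    finally have "S h * y = scale (c ^ n) (y * S h)" by (simp add: inv)
    then have "y * S h = scale (inverse (c ^ n)) (S h * y)" using \<open>c \<noteq> 0\<close> by simp
    moreover have "g [^]\<^bsub>GG\<^esub> i = S h"
      using True by (simp add: int_pow_def2 h_def n_def inv_group_like[OF nat_mem] del: pow_nat)
    moreover have "c powi i = inverse (c ^ n)"
      using True by (simp add: power_int_def n_def power_inverse)
    ultimately show ?thesis by (simp only:)
  qed
qed

text \<open>
  If the weights differ, slicing with a functional that separates them isolates one summand. If they
  agree, conjugation by the common weight does, because the eigenvalues differ.
\<close>

lemma two_eigenvectors_independent:
  assumes g: "g1 \<in> GL" "g2 \<in> GL"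
    and y1: "primitive_of_weight g1 y1" "y1 \<notin> C0" "y1 * g1 = scale c1 (g1 * y1)"
    and y2: "primitive_of_weight g2 y2" "y2 \<notin> C0" "y2 * g2 = scale c2 (g2 * y2)"
    and "c1 \<noteq> c2" and a: "scale a1 y1 + scale a2 y2 \<in> C0"
  shows "a1 = 0" "a2 = 0"
proof -
  note sub = subspace_add[OF group_like_span_subspace] subspace_diff[OF group_like_span_subspace]
    subspace_scale[OF group_like_span_subspace]
  have nontrivial: "b = 0" if "scale b y \<in> C0" "y \<notin> C0" for b y
  proof (rule ccontr)
    assume "b \<noteq> 0"
    then have "y = scale (inverse b) (scale b y)" by simp
    with that sub(3) show False by metis
  qed
  have one: "scale b 1 \<in> C0" for b
    by (rule sub(3)) (simp add: group_like_span_def span_base group_like_one)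
  have slice: "scale (\<phi> g1 * a1) y1 + scale (\<phi> g2 * a2) y2 \<in> C0" if \<phi>: "functional \<phi>" for \<phi>
  proof -
    interpret sl: Vector_Spaces.linear scale scale "slice_left \<phi>" by (rule slice_left_linear[OF \<phi>])
    have "slice_left \<phi> (scale a1 y1 + scale a2 y2)
        - (scale (a1 * \<phi> y1) 1 + scale (a2 * \<phi> y2) 1) \<in> C0"
      by (intro sub one slice_left_group_like_span[OF \<phi> a])
    then show ?thesis
      by (simp add: sl.add sl.scale slice_left_primitive[OF \<phi> y1(1)] slice_left_primitive[OF \<phi> y2(1)]
          scale_right_distrib mult.commute)
  qed
  show a1: "a1 = 0"
  proof (cases "g1 = g2")
    case False
    obtain \<phi> where \<phi>: "functional \<phi>" "\<And>h. h \<in> GL \<Longrightarrow> \<phi> h = (if h = g1 then 1 else 0)"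
      using dual_functional[OF independent_group_likes g(1)] by blast
    then have "scale a1 y1 \<in> C0" using slice[OF \<phi>(1)] g False by simp
    then show ?thesis using nontrivial y1(2) by blast
  next
    case True
    have "S g1 * ((scale a1 y1 + scale a2 y2) * g1) \<in> C0"
      by (intro group_like_span_mult_left group_like_span_mult_right group_like_inverse(1) g a)
    moreover have "S g1 * ((scale a1 y1 + scale a2 y2) * g1) = scale (a1 * c1) y1 + scale (a2 * c2) y2"
      using y2(3) by (simp add: distrib_left distrib_right scale_mult_left scale_mult_right y1(3)
          True[symmetric] group_like_inverse[OF g(1)] flip: mult.assoc)
    ultimately have "(scale (a1 * c1) y1 + scale (a2 * c2) y2) - scale c2 (scale a1 y1 + scale a2 y2) \<in> C0"
      using sub a by simp
    then have "scale (a1 * (c1 - c2)) y1 \<in> C0"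
      by (simp add: scale_right_distrib algebra_simps flip: scale_left_diff_distrib)
    then have "a1 * (c1 - c2) = 0" using nontrivial y1(2) by blast
    then show ?thesis using \<open>c1 \<noteq> c2\<close> by simp
  qed
  show "a2 = 0" using nontrivial[of a2 y2] a y2(2) by (simp add: a1)
qed

end

text \<open>
  Let \<open>K\<close> be the space of skew primitive elements of weight \<open>g\<close> on which conjugation by \<open>g\<close> is the scalar \<open>c\<close>.
  Conjugation by \<open>h\<close> preserves \<open>K\<close>, as \<open>g\<close> and \<open>h\<close> commute, and one of its powers is a scalar there,
  since a power of \<open>h\<close> is a power of \<open>g\<close>. So it has an eigenvector in \<open>K\<close>, and because \<open>c \<noteq> 1\<close> no nonzero
  element of \<open>K\<close> lies in the span of the group-likes.
\<close>

lemma common_eigenvector: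
  fixes scale :: "'k::alg_closed_field \<Rightarrow> 'h::ring_1 \<Rightarrow> 'h"
  assumes hopf: "hopf_algebra scale \<Delta> \<epsilon> S"
  defines "GG \<equiv> group_like_group scale \<Delta>"
  assumes g: "g \<in> group_likes scale \<Delta>" and h: "h \<in> group_likes scale \<Delta>"
    and comm: "g * h = h * g" and "j \<noteq> 0" and pow: "g [^]\<^bsub>GG\<^esub> (i::int) = h [^]\<^bsub>GG\<^esub> (j::int)"
    and y: "hopf_algebra.primitive_of_weight \<Delta> g y" "y \<notin> group_like_span scale \<Delta>"
    and c: "S g * y * g - scale c y \<in> group_like_span scale \<Delta>" "c \<noteq> 0" "c \<noteq> 1"
  obtains v \<mu> where "hopf_algebra.primitive_of_weight \<Delta> g v" "v \<notin> group_like_span scale \<Delta>"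
    "v * g = scale c (g * v)" "v * h = scale \<mu> (h * v)" "\<mu> powi j = c powi i"
proof -
  interpret hopf_algebra scale \<Delta> \<epsilon> S by fact
  interpret GG: group GG unfolding GG_def by (rule group_group_like)
  have carrier: "carrier GG = GL" and mult: "x \<otimes>\<^bsub>GG\<^esub> x' = x * x'" for x x'
    by (simp_all add: GG_def group_like_group_def)
  obtain y0 where y0: "primitive_of_weight g y0" "y0 \<notin> C0" "y0 * g = scale c (g * y0)"
    using exact_eigenvector[OF g y c(1,3)] .
  define K where "K = {v. primitive_of_weight g v} \<inter> {v. v * g = scale c (g * v)}"
  define T where "T v = S h * v * h" for v
  have T: "Vector_Spaces.linear scale scale T"
    by unfold_locales (simp_all add: T_def distrib_left distrib_right scale_mult_left scale_mult_right)
  have "subspace {v. v * g = scale c (g * v)}"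
    by (rule subspaceI)
      (auto simp: distrib_left distrib_right scale_mult_left scale_mult_right scale_right_distrib mult.commute)
  then have K: "subspace K"
    unfolding K_def by (rule subspace_inter[OF primitive_subspace])
  have TK: "T v \<in> K" if "v \<in> K" for v
  proof -
    have "S h * g = g * S h"
      using comm group_like_inverse(2,3)[OF h] by (metis mult.assoc mult_1 mult_1_right)
    have "T v * g = S h * (v * g) * h" by (simp add: T_def mult.assoc comm)
    also have "\<dots> = scale c (S h * g * v * h)"
      using that by (simp add: K_def scale_mult_left scale_mult_right mult.assoc)
    also have "\<dots> = scale c (g * T v)" by (simp add: \<open>S h * g = g * S h\<close> T_def mult.assoc)
    finally show ?thesis
      using that primitive_conj[OF _ h comm] by (simp add: K_def T_def)
  qed
  \<comment> \<open>If \<open>j\<close> is negative, both exponents change sign, so that an honest power of \<open>h\<close> results.\<close>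
  obtain b :: nat and e :: int where b: "b > 0" "h ^ b = g [^]\<^bsub>GG\<^esub> e"
    and be: "\<And>\<mu>. \<mu> \<noteq> 0 \<Longrightarrow> \<mu> ^ b = c powi e \<Longrightarrow> \<mu> powi j = c powi i"
  proof -
    have nat: "h [^]\<^bsub>GG\<^esub> n = h ^ n" for n :: nat
      by (induction n) (simp_all add: mult power_Suc2 GG_def group_like_group_def del: power_Suc)
    show thesis
    proof (cases "j > 0")
      case True
      then show thesis
        using that[of "nat j" i] pow nat by (simp add: int_pow_def2 power_int_def del: pow_nat)
    next
      case False
      then have "h ^ nat (- j) = h [^]\<^bsub>GG\<^esub> (- j)" by (simp add: int_pow_def2 nat del: pow_nat)
      also have "\<dots> = g [^]\<^bsub>GG\<^esub> (- i)"
        using g h by (simp add: GG.int_pow_neg carrier pow)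
      finally show thesis
        using that[of "nat (- j)" "- i"] False \<open>j \<noteq> 0\<close>
        by (auto simp: power_int_def power_inverse c(2) power_int_minus split: if_splits)
    qed
  qed
  have Tpow: "(T ^^ n) v = S h ^ n * v * h ^ n" for n v
  proof (induction n)
    case (Suc n)
    then show ?case by (simp add: T_def mult.assoc power_commutes)
  qed simp
  have inv_pow: "S h ^ n * h ^ n = 1" for n
  proof (induction n)
    case (Suc n)
    have "S h ^ Suc n * h ^ Suc n = S h ^ n * (S h * h) * h ^ n"
      by (simp add: mult.assoc power_Suc2 del: power_Suc) (simp add: power_commutes)
    then show ?case using Suc by (simp add: group_like_inverse[OF h])
  qed simp
  have eigen: "(T ^^ b) v = scale (c powi e) v" if "v \<in> K" for v
  proof -
    have "v * h ^ b = scale (c powi e) (h ^ b * v)"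
      using eigenvector_int_pow[OF g _ c(2), of v e] that by (simp add: b(2) K_def GG_def)
    then show ?thesis by (simp add: Tpow mult.assoc scale_mult_right) (simp add: inv_pow flip: mult.assoc)
  qed
  have "y0 \<in> K" using y0 by (simp add: K_def)
  moreover have "y0 \<noteq> 0" using y0(2) subspace_0[OF group_like_span_subspace] by auto
  ultimately obtain v \<mu> where v: "v \<in> K" "v \<noteq> 0" "T v = scale \<mu> v"
    using eigenvector_exists[OF T K TK _ _ b(1) eigen] by metis
  interpret T: Vector_Spaces.linear scale scale T by (fact T)
  have "(T ^^ n) v = scale (\<mu> ^ n) v" for n
    by (induction n) (simp_all add: v(3) T.scale mult.commute)
  then have "scale (\<mu> ^ b - c powi e) v = 0" using eigen[OF v(1)] by (simp add: scale_left_diff_distrib)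
  then have \<mu>: "\<mu> ^ b = c powi e" using v(2) by simp
  then have "\<mu> \<noteq> 0" using b(1) c(2) by (auto simp: zero_power)
  have "h * T v = v * h" by (simp add: T_def group_like_inverse[OF h] flip: mult.assoc)
  then have "v * h = scale \<mu> (h * v)" by (simp add: v(3) scale_mult_right)
  moreover have "v \<notin> C0" using trivial_eigenvector_eq_0[OF g _ _ _ c(3)] v(1,2) by (auto simp: K_def)
  ultimately show thesis using that[of v \<mu>] be[OF \<open>\<mu> \<noteq> 0\<close> \<mu>] v(1) by (simp add: K_def)
qed

section \<open>Words in braided skew primitive elements\<close>

text \<open>
  A diagonal braided vector space with basis \<open>Y\<close> and braiding matrix \<open>q\<close>, realized by skew primitive
  elements. Independence holds modulo the group-likes, because these are the words of length zero among
  the elements \<open>g w\<close> to be shown independent.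
\<close>

locale braided_letters = hopf_algebra scale \<Delta> \<epsilon> S
  for scale :: "'k::field \<Rightarrow> 'h::ring_1 \<Rightarrow> 'h" and \<Delta> \<epsilon> S +
  fixes Y :: "'a::finite \<Rightarrow> 'h" and G :: "'a \<Rightarrow> 'h" and q :: "'a \<Rightarrow> 'a \<Rightarrow> 'k"
  assumes G_group_like: "G x \<in> group_likes scale \<Delta>"
    and Y_primitive: "primitive_of_weight (G x) (Y x)"
    and Y_G: "Y x * G m = scale (q x m) (G m * Y x)"
    and Y_independent: "(\<Sum>x\<in>UNIV. scale (a x) (Y x)) \<in> group_like_span scale \<Delta> \<Longrightarrow> a x = 0"
    and nonresonant: "2 \<le> length w \<Longrightarrow> full_twist q w \<noteq> 1"
begin

definition "word w = prod_list (map Y w)"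
definition "word_weight w = prod_list (map G w)"

lemma word_simps [simp]:
  "word [] = 1" "word (x # w) = Y x * word w"
  "word_weight [] = 1" "word_weight (x # w) = G x * word_weight w"
  by (simp_all add: word_def word_weight_def)

lemma word_weight_group_like: "word_weight w \<in> GL"
  by (induction w) (simp_all add: group_like_one group_like_mult G_group_like)

lemma Y_word_weight: "Y x * word_weight v = scale (\<Prod>m\<leftarrow>v. q x m) (word_weight v * Y x)"
proof (induction v)
  case (Cons m v)
  have "Y x * word_weight (m # v) = scale (q x m) (G m * (Y x * word_weight v))"
    by (simp add: Y_G scale_mult_left flip: mult.assoc)
  then show ?case
    by (simp add: Cons.IH scale_mult_right mult.assoc)
qed simp

lemma comul_word:
  "(\<Sum>(c, u, v)\<leftarrow>unshuffle q w. gen (scale c (word_weight v * word u), word v)) \<in> \<Delta> (word w)"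
proof (induction w)
  case Nil
  show ?case using group_like_one by (simp add: group_like_iff)
next
  case (Cons x w)
  let ?F = "\<lambda>(c, u, v). (scale c (word_weight v * word u), word v)"
  let ?f = "\<Sum>p\<leftarrow>unshuffle q w. gen (?F p)"
  have "tensor_mult (gen (Y x, 1) + gen (G x, Y x)) ?f \<in> \<Delta> (Y x * word w)"
    using Cons.IH Y_primitive[of x] comul_mult
    by (simp add: primitive_of_weight_def case_prod_unfold)
  then have "tensor_mult (gen (Y x, 1)) ?f + tensor_mult (gen (G x, Y x)) ?f \<in> \<Delta> (Y x * word w)"
    by (simp only: tensor_mult_add_left)
  also have "tensor_mult (gen (Y x, 1)) ?f = (\<Sum>(c, u, v)\<leftarrow>unshuffle q w.
      gen (scale (c * (\<Prod>m\<leftarrow>v. q x m)) (word_weight v * word (x # u)), word v))"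
    unfolding tensor_mult_gen_left lin_ext_sum_list[OF vector_space_free_scale]
    by (intro arg_cong[of _ _ sum_list] map_cong refl)
      (auto simp: scale_mult_right Y_word_weight scale_mult_left simp flip: mult.assoc)
  also have "tensor_mult (gen (G x, Y x)) ?f = (\<Sum>(c, u, v)\<leftarrow>unshuffle q w.
      gen (scale c (word_weight (x # v) * word u), word (x # v)))"
    unfolding tensor_mult_gen_left lin_ext_sum_list[OF vector_space_free_scale]
    by (intro arg_cong[of _ _ sum_list] map_cong refl)
      (auto simp: scale_mult_right mult.assoc)
  finally show ?case by (simp add: o_def case_prod_unfold)
qed

lemma comul_group_like_word:
  assumes "h \<in> GL"
  shows "(\<Sum>(c, u, v)\<leftarrow>unshuffle q w. gen (scale c (h * word_weight v * word u), h * word v))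
    \<in> \<Delta> (h * word w)"
proof -
  let ?F = "\<lambda>(c, u, v). (scale c (word_weight v * word u), word v)"
  have "tensor_mult (gen (h, h)) (\<Sum>p\<leftarrow>unshuffle q w. gen (?F p)) \<in> \<Delta> (h * word w)"
    using assms comul_word[of w] comul_mult by (simp add: group_like_iff case_prod_unfold)
  then show ?thesis
    unfolding tensor_mult_gen_left lin_ext_sum_list[OF vector_space_free_scale]
    by (simp add: case_prod_unfold scale_mult_right mult.assoc)
qed

lemma slice_right_word:
  assumes "functional \<psi>" "h \<in> GL"
  shows "slice_right \<psi> (h * word w) = (\<Sum>(c, u, v)\<leftarrow>unshuffle q w.
    scale (c * \<psi> (h * word v)) (h * word_weight v * word u))"
proof -
  let ?F = "\<lambda>(c, u, v). (scale c (h * word_weight v * word u), h * word v)"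
  have "(\<Sum>p\<leftarrow>unshuffle q w. gen (?F p)) \<in> \<Delta> (h * word w)"
    using comul_group_like_word[OF assms(2)] by (simp add: case_prod_unfold)
  from slice_right_eq[OF assms(1) this] show ?thesis
    unfolding lin_ext_sum_list[OF vector_space_axioms]
    by (simp add: case_prod_unfold mult.commute)
qed

definition shifted_word :: "'h \<times> 'a list \<Rightarrow> 'h" where
  "shifted_word p = fst p * word (snd p)"

definition shifted_index :: "nat \<Rightarrow> ('h \<times> 'a list) set" where
  "shifted_index n = GL \<times> {w. length w \<le> n}"

lemma sum_over_words:
  fixes f :: "'h \<times> 'a list \<Rightarrow> 'x::comm_monoid_add"
  assumes "finite A" and "\<And>p. p \<notin> A \<Longrightarrow> f p = 0"
  shows "(\<Sum>p\<in>A. if fst p = h \<and> length (snd p) = n then f p else 0)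
    = (\<Sum>w | length w = n. f (h, w))"
proof -
  let ?B = "Pair h ` {w. length w = n}"
  have "(\<Sum>p\<in>A. if fst p = h \<and> length (snd p) = n then f p else 0) = (\<Sum>p\<in>?B. f p)"
    by (rule sum.mono_neutral_cong) (use assms finite_words in \<open>auto intro: finite_imageI\<close>)
  then show ?thesis by (simp add: sum.reindex inj_on_def)
qed

text \<open>
  In length one no functional dual to words is available yet. Instead apply \<open>(id \<otimes> \<psi>) \<Delta>\<close> with \<open>\<psi>\<close> dual to
  the group-like element \<open>h\<close>: modulo the group-likes only the terms \<open>h y\<close> survive.
\<close>

lemma linear_coefficients_eq_0:
  assumes A: "finite A" "A \<subseteq> shifted_index 1" and a: "\<And>p. p \<notin> A \<Longrightarrow> a p = 0"
    and rel: "(\<Sum>p\<in>A. scale (a p) (shifted_word p)) = 0" and h: "h \<in> GL"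
  shows "a (h, [x]) = 0"
proof -
  obtain \<psi> where \<psi>: "functional \<psi>" "\<And>j. j \<in> GL \<Longrightarrow> \<psi> j = (if j = h then 1 else 0)"
    using dual_functional[OF independent_group_likes h] by blast
  interpret sl: Vector_Spaces.linear scale scale "slice_right \<psi>"
    by (rule slice_right_linear[OF \<psi>(1)])
  \<comment> \<open>The part of the slice that is not in the span of the group-like elements.\<close>
  let ?t = "\<lambda>p. if fst p = h \<and> length (snd p) = 1 then shifted_word p else 0"
  have C0_sub: "subspace C0" unfolding group_like_span_def by (rule subspace_span)
  have GL_C0: "g \<in> C0" if "g \<in> GL" for g
    unfolding group_like_span_def using that by (rule span_base)
  have "slice_right \<psi> (shifted_word p) - ?t p \<in> C0" if p: "p \<in> A" for p
  proof -
    obtain k w where kw: "p = (k, w)" "k \<in> GL" "length w \<le> 1"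
      using p A(2) by (auto simp: shifted_index_def)
    show ?thesis
    proof (cases w)
      case Nil
      then show ?thesis
        using kw subspace_scale[OF C0_sub GL_C0]
        by (simp add: shifted_word_def slice_right_group_like[OF \<psi>(1)])
    next
      case (Cons y v)
      then have w: "w = [y]" using kw by simp
      have "slice_right \<psi> (shifted_word p) = scale (\<psi> k) (k * Y y) + scale (\<psi> (k * Y y)) (k * G y)"
        unfolding kw shifted_word_def fst_conv snd_conv slice_right_word[OF \<psi>(1) kw(2)] w
        by simp
      then show ?thesis
        using kw w \<psi>(2)[OF kw(2)] subspace_scale[OF C0_sub GL_C0[OF group_like_mult[OF kw(2) G_group_like]]]
        by (auto simp: shifted_word_def)
    qed
  qed
  then have "(\<Sum>p\<in>A. scale (a p) (slice_right \<psi> (shifted_word p) - ?t p)) \<in> C0"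
    by (intro subspace_sum[OF C0_sub] subspace_scale[OF C0_sub])
  also have "(\<Sum>p\<in>A. scale (a p) (slice_right \<psi> (shifted_word p) - ?t p))
      = slice_right \<psi> (\<Sum>p\<in>A. scale (a p) (shifted_word p)) - (\<Sum>p\<in>A. scale (a p) (?t p))"
    by (simp add: sl.sum sl.scale scale_right_diff_distrib sum_subtractf)
  also have "(\<Sum>p\<in>A. scale (a p) (?t p))
      = (\<Sum>p\<in>A. if fst p = h \<and> length (snd p) = 1 then scale (a p) (shifted_word p) else 0)"
    by (intro sum.cong) auto
  also have "\<dots> = (\<Sum>w | length w = 1. scale (a (h, w)) (shifted_word (h, w)))"
    by (rule sum_over_words[OF A(1)]) (simp add: a)
  also have "\<dots> = (\<Sum>y\<in>UNIV. scale (a (h, [y])) (h * Y y))"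
    unfolding One_nat_def sum_words_Suc by (simp add: shifted_word_def)
  finally have "- (\<Sum>y\<in>UNIV. scale (a (h, [y])) (h * Y y)) \<in> C0" by (simp add: rel sl.zero)
  then have "(\<Sum>y\<in>UNIV. scale (a (h, [y])) (h * Y y)) \<in> C0"
    using subspace_neg[OF C0_sub] by fastforce
  from group_like_span_mult_left[OF group_like_inverse(1)[OF h] this]
  have "(\<Sum>y\<in>UNIV. scale (a (h, [y])) (Y y)) \<in> C0"
    by (simp add: sum_distrib_left scale_mult_right group_like_inverse[OF h] flip: mult.assoc)
  then show ?thesis by (rule Y_independent)
qed

text \<open>
  Apply \<open>\<phi> \<otimes> \<psi>\<close> to the comultiplication of the relation, with \<open>\<phi>\<close> dual to \<open>h g\<^sub>x u\<close> and \<open>\<psi>\<close> dual to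
  \<open>h y\<^sub>x\<close>. Both functionals are only known on words of length at most \<open>n\<close>. In a term with a factor of length
  \<open>n + 1\<close> the other factor is group-like, hence is killed because neither \<open>u\<close> nor the
  one-letter word \<open>x\<close> is empty.
  What survives is the skew derivative \<open>\<partial>\<^sub>x\<close> of the part of top length, at \<open>u\<close>.
\<close>

lemma top_coefficients_eq_0:
  assumes IH: "independent_family scale shifted_word (shifted_index n)" and "n > 0"
    and A: "finite A" "A \<subseteq> shifted_index (Suc n)" and a: "\<And>p. p \<notin> A \<Longrightarrow> a p = 0"
    and rel: "(\<Sum>p\<in>A. scale (a p) (shifted_word p)) = 0"
    and h: "h \<in> GL" and w: "length w = Suc n"
  shows "a (h, w) = 0"
proof -
  have "skew_derivative q x (\<lambda>w. a (h, w)) u = 0" if u: "length u = n" for x u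
  proof -
    have "(h * G x, u) \<in> shifted_index n"
      using h u by (simp add: shifted_index_def group_like_mult G_group_like)
    then obtain \<phi> where \<phi>: "functional \<phi>"
      "\<And>p. p \<in> shifted_index n \<Longrightarrow> \<phi> (shifted_word p) = (if p = (h * G x, u) then 1 else 0)"
      using dual_functional[OF IH] by blast
    have "(h, [x]) \<in> shifted_index n"
      using h \<open>n > 0\<close> by (simp add: shifted_index_def)
    then obtain \<psi> where \<psi>: "functional \<psi>"
      "\<And>p. p \<in> shifted_index n \<Longrightarrow> \<psi> (shifted_word p) = (if p = (h, [x]) then 1 else 0)"
      using dual_functional[OF IH] by blast
    interpret \<phi>: Vector_Spaces.linear scale "(*)" \<phi> by (fact \<phi>(1))
    interpret sl: Vector_Spaces.linear scale scale "slice_right \<psi>"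
      by (rule slice_right_linear[OF \<psi>(1)])
    have \<phi>_sum_list: "\<phi> (\<Sum>t\<leftarrow>xs. F t) = (\<Sum>t\<leftarrow>xs. \<phi> (F t))" for xs :: "('k \<times> 'a list \<times> 'a list) list" and F
      by (induction xs) (simp_all add: \<phi>.zero \<phi>.add)
    have pair: "\<phi> (slice_right \<psi> (shifted_word p))
        = (if fst p = h \<and> length (snd p) = Suc n then unshuffle_coeff q (snd p) u [x] else 0)"
      if p: "p \<in> A" for p
    proof -
      obtain k w where kw: "p = (k, w)" "k \<in> GL" "length w \<le> Suc n"
        using p A(2) by (auto simp: shifted_index_def)
      have summand: "c * \<psi> (k * word v) * \<phi> (k * word_weight v * word u')
          = (if (k = h \<and> length w = Suc n) \<and> u' = u \<and> v = [x] then c else 0)"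
        if t: "(c, u', v) \<in> set (unshuffle q w)" for c u' v
      proof -
        have len: "length u' + length v = length w" by (rule unshuffle_length[OF t])
        have \<psi>v: "\<psi> (k * word v) = (if k = h \<and> v = [x] then 1 else 0)" if "length v \<le> n"
          using \<psi>(2)[of "(k, v)"] that kw by (simp add: shifted_word_def shifted_index_def)
        have \<phi>u: "\<phi> (k * word_weight v * word u') = (if k * word_weight v = h * G x \<and> u' = u then 1 else 0)"
          if "length u' \<le> n"
          using \<phi>(2)[of "(k * word_weight v, u')"] that kw
          by (simp add: shifted_word_def shifted_index_def group_like_mult word_weight_group_like)
        have "length v \<le> n \<and> length u' \<le> n \<or> length v = Suc n \<and> length u' = 0
            \<or> length u' = Suc n \<and> length v = 0"
          using len kw(3) by linarith
        then consider "length v \<le> n" "length u' \<le> n" | "length v = Suc n" "u' = []"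
          | "length u' = Suc n" "v = []"
          by auto
        then show ?thesis
        proof cases
          case 1
          then show ?thesis using \<psi>v \<phi>u len u by auto
        next
          case 2
          then show ?thesis using \<phi>u u \<open>n > 0\<close> by auto
        next
          case 3
          then show ?thesis using \<psi>v by auto
        qed
      qed
      have "\<phi> (slice_right \<psi> (shifted_word p)) = (\<Sum>(c, u', v)\<leftarrow>unshuffle q w.
          c * \<psi> (k * word v) * \<phi> (k * word_weight v * word u'))"
        unfolding kw shifted_word_def fst_conv snd_conv slice_right_word[OF \<psi>(1) kw(2)] \<phi>_sum_list
        by (simp add: case_prod_unfold \<phi>.scale)
      also have "\<dots> = (\<Sum>(c, u', v)\<leftarrow>unshuffle q w.
          if (k = h \<and> length w = Suc n) \<and> u' = u \<and> v = [x] then c else 0)"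
        by (intro arg_cong[of _ _ sum_list] map_cong refl) (auto simp: summand)
      finally show ?thesis
        by (simp add: kw unshuffle_coeff_def case_prod_unfold sum_list_if_const)
    qed
    have "0 = \<phi> (slice_right \<psi> (\<Sum>p\<in>A. scale (a p) (shifted_word p)))"
      by (simp add: rel sl.zero \<phi>.zero)
    also have "\<dots> = (\<Sum>p\<in>A. a p * \<phi> (slice_right \<psi> (shifted_word p)))"
      by (simp add: sl.sum \<phi>.sum sl.scale \<phi>.scale)
    also have "\<dots> = (\<Sum>p\<in>A. if fst p = h \<and> length (snd p) = Suc n
        then a p * unshuffle_coeff q (snd p) u [x] else 0)"
      by (intro sum.cong refl) (simp add: pair)
    also have "\<dots> = (\<Sum>w | length w = Suc n. a (h, w) * unshuffle_coeff q w u [x])"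
      by (subst sum_over_words[OF A(1)]) (simp_all add: a)
    also have "\<dots> = skew_derivative q x (\<lambda>w. a (h, w)) u"
      using sum_unshuffle_coeff[of "\<lambda>w. a (h, w)" q u x] u by simp
    finally show ?thesis by simp
  qed
  from skew_derivative_kernel[OF nonresonant this w] show ?thesis by blast
qed

text \<open>
  The vanishing of the top coefficients reduces a relation to one between shorter words.
\<close>

theorem independent_words: "independent_family scale shifted_word (shifted_index n)"
proof (induction n)
  case 0
  show ?case
    unfolding independent_family_def
  proof (intro allI impI)
    fix A and a :: "'h \<times> 'a list \<Rightarrow> 'k"
    assume A: "finite A" "A \<subseteq> shifted_index 0" "(\<Sum>p\<in>A. scale (a p) (shifted_word p)) = 0"
    have inj: "inj_on fst A" and fst: "fst ` A \<subseteq> GL"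
      using A(2) by (auto simp: inj_on_def shifted_index_def)
    have "(\<Sum>g\<in>fst ` A. scale (a (g, [])) g) = (\<Sum>p\<in>A. scale (a p) (shifted_word p))"
      unfolding sum.reindex[OF inj] using A(2)
      by (intro sum.cong) (auto simp: shifted_word_def shifted_index_def)
    then have "\<forall>g\<in>fst ` A. a (g, []) = 0"
      using independent_group_likes[unfolded independent_family_def, rule_format,
          of "fst ` A" "\<lambda>g. a (g, [])"] A fst by auto
    then show "\<forall>p\<in>A. a p = 0" using A(2) by (fastforce simp: shifted_index_def)
  qed
next
  case (Suc n)
  show ?case
    unfolding independent_family_def
  proof (intro allI impI)
    fix A and b :: "'h \<times> 'a list \<Rightarrow> 'k"
    assume A: "finite A" "A \<subseteq> shifted_index (Suc n)" "(\<Sum>p\<in>A. scale (b p) (shifted_word p)) = 0"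
    \<comment> \<open>Extended by 0, the coefficients of a given length become a function on all words.\<close>
    define a where "a p = (if p \<in> A then b p else 0)" for p
    have a: "a p = 0" if "p \<notin> A" for p using that by (simp add: a_def)
    have rel: "(\<Sum>p\<in>A. scale (a p) (shifted_word p)) = 0"
      using A(3) by (simp add: a_def)
    have top: "a (h, w) = 0" if "h \<in> GL" "length w = Suc n" for h w
    proof (cases "n = 0")
      case True
      then obtain x where "w = [x]" using \<open>length w = Suc n\<close> by (auto simp: length_Suc_conv)
      then show ?thesis using linear_coefficients_eq_0[OF A(1) _ a rel \<open>h \<in> GL\<close>] A(2) True by simp
    next
      case False
      then show ?thesis using top_coefficients_eq_0[OF Suc.IH _ A(1,2) a rel that] by simp
    qed
    let ?A = "A \<inter> shifted_index n"
    have "(\<Sum>p\<in>?A. scale (a p) (shifted_word p)) = (\<Sum>p\<in>A. scale (a p) (shifted_word p))"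
    proof (rule sum.mono_neutral_left)
      show "\<forall>p\<in>A - ?A. scale (a p) (shifted_word p) = 0"
      proof
        fix p assume "p \<in> A - ?A"
        then have "a p = 0" using A(2) top[of "fst p" "snd p"]
          by (cases p) (auto simp: shifted_index_def not_le less_eq_Suc_le dest!: subsetD)
        then show "scale (a p) (shifted_word p) = 0" by simp
      qed
    qed (use A(1) in auto)
    then have low: "\<forall>p\<in>?A. a p = 0"
      using Suc.IH[unfolded independent_family_def, rule_format, of ?A a] A(1) rel by auto
    show "\<forall>p\<in>A. b p = 0"
    proof
      fix p assume p: "p \<in> A"
      have "a p = 0"
      proof (cases "p \<in> shifted_index n")
        case True
        with low p show ?thesis by blast
      next
        case False
        then show ?thesis using p A(2) top[of "fst p" "snd p"]
          by (cases p) (auto simp: shifted_index_def not_le less_eq_Suc_le dest!: subsetD)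
      qed
      then show "b p = 0" using p by (simp add: a_def)
    qed
  qed
qed

end

section \<open>Growth\<close>

context hopf_algebra
begin

lemma prod_list_in_span:
  assumes "set xs \<subseteq> span B"
  shows "prod_list xs \<in> span (prod_list ` {ys. set ys \<subseteq> B \<and> length ys = length xs})"
  using assms
proof (induction xs)
  case Nil
  then show ?case by (auto intro!: span_base)
next
  case (Cons x xs)
  let ?P = "\<lambda>n. prod_list ` {ys. set ys \<subseteq> B \<and> length ys = n}"
  have *: "b * z \<in> span (?P (Suc n))" if "b \<in> B" "z \<in> span (?P n)" for b z n
    using that(2)
  proof (induction rule: span_induct_alt)
    case base
    then show ?case by (simp add: span_zero)
  next
    case (step c x y)
    then obtain ys where "x = prod_list ys" "set ys \<subseteq> B" "length ys = n" by auto
    then have "b * x \<in> ?P (Suc n)" using that(1) by (auto intro!: image_eqI[of _ _ "b # ys"])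
    then show ?case
      using step.IH by (simp add: distrib_left scale_mult_right span_add span_scale span_base)
  qed
  have "x \<in> span B" "prod_list xs \<in> span (?P (length xs))" using Cons by auto
  then have "x * prod_list xs \<in> span (?P (Suc (length xs)))"
  proof (induction x rule: span_induct_alt)
    case base
    then show ?case by (simp add: span_zero)
  next
    case (step c b y)
    then show ?case
      using * by (simp add: distrib_right scale_mult_left span_add span_scale)
  qed
  then show ?case by simp
qed

text \<open>
  The powers of \<open>span (insert 1 (range Y))\<close> are finite dimensional and contain the words, so their
  dimension is at least \<open>card (UNIV :: 'a set) ^ n\<close>.
\<close>

lemma exponential_growth_if_independent_products:
  fixes Y :: "'a::finite \<Rightarrow> 'h"
  assumes card: "2 \<le> card (UNIV :: 'a set)"
    and inj: "\<And>n. inj_on (\<lambda>w. prod_list (map Y w)) {w. length w = n}"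
    and indep: "\<And>n. independent ((\<lambda>w. prod_list (map Y w)) ` {w. length w = n})"
  shows "exponential_growth scale"
proof -
  let ?B = "insert 1 (range Y)"
  let ?V = "span ?B"
  have dim: "card (UNIV :: 'a set) ^ n \<le> dim (power_span scale ?V n)" for n
  proof -
    let ?W = "(\<lambda>w. prod_list (map Y w)) ` {w. length w = n}"
    let ?P = "prod_list ` {ys. set ys \<subseteq> ?B \<and> length ys = n}"
    have fin: "finite ?P" by (intro finite_imageI finite_lists_length_eq) simp
    have "power_span scale ?V n \<subseteq> span ?P"
      unfolding power_span_def
      by (rule span_minimal[OF _ subspace_span]) (auto intro: prod_list_in_span)
    moreover obtain D where D: "D \<subseteq> power_span scale ?V n" "independent D"
      "power_span scale ?V n \<subseteq> span D" "card D = dim (power_span scale ?V n)"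
      by (rule basis_exists)
    ultimately have "finite D" using independent_span_bound[OF fin D(2)] by blast
    moreover have "?W \<subseteq> power_span scale ?V n"
      unfolding power_span_def
    proof (intro image_subsetI span_base CollectI)
      fix w :: "'a list" assume "w \<in> {w. length w = n}"
      then show "\<exists>xs. prod_list (map Y w) = prod_list xs \<and> length xs = n \<and> set xs \<subseteq> ?V"
        by (intro exI[of _ "map Y w"]) (auto intro: span_base)
    qed
    ultimately have "card ?W \<le> card D" using independent_span_bound[OF _ indep] D(3) by blast
    moreover have "card ?W = card (UNIV :: 'a set) ^ n"
      using card_lists_length_eq[of "UNIV :: 'a set" n] by (simp add: card_image[OF inj])
    ultimately show ?thesis by (simp add: D(4))
  qed
  have "ereal (real (card (UNIV :: 'a set))) \<le> limsup (\<lambda>n. ereal (root n (real (dim (power_span scale ?V n)))))"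
  proof (rule le_Limsup)
    show "\<forall>\<^sub>F n in sequentially. ereal (real (card (UNIV :: 'a set))) \<le> ereal (root n (real (dim (power_span scale ?V n))))"
      using eventually_gt_at_top[of 0]
    proof eventually_elim
      case (elim n)
      have "real (card (UNIV :: 'a set)) = root n (real (card (UNIV :: 'a set)) ^ n)"
        using elim by (simp add: real_root_power_cancel)
      also have "\<dots> \<le> root n (real (dim (power_span scale ?V n)))"
        using dim[of n] elim by (simp flip: of_nat_power)
      finally show ?case by simp
    qed
  qed simp
  moreover have "1 < ereal (real (card (UNIV :: 'a set)))" using card by (simp add: one_ereal_def)
  ultimately have "1 < limsup (\<lambda>n. ereal (root n (real (dim (power_span scale ?V n)))))"
    by (rule less_le_trans[rotated])
  moreover have "\<exists>B. finite B \<and> ?V = span B" by (intro exI[of _ ?B]) simp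
  moreover have "1 \<in> ?V" by (simp add: span_base)
  ultimately show ?thesis
    unfolding exponential_growth_def using subspace_span[of ?B] by blast
qed

end

context braided_letters
begin

theorem exponential_growth_if_two_letters:
  assumes "2 \<le> card (UNIV :: 'a set)" shows "exponential_growth scale"
proof (rule exponential_growth_if_independent_products[OF assms])
  fix n
  note fam = independent_words[of n, unfolded independent_family_def, rule_format]
  have coeff: "a w = 0"
    if "A \<subseteq> {w. length w = n}" "(\<Sum>w\<in>A. scale (a w) (word w)) = 0" "w \<in> A" for A a w
  proof -
    have "finite A" using that(1) finite_words finite_subset by blast
    have "(\<Sum>p\<in>Pair 1 ` A. scale (a (snd p)) (shifted_word p)) = 0"
      using that(2) by (simp add: sum.reindex inj_on_def shifted_word_def)
    moreover have "Pair 1 ` A \<subseteq> shifted_index n"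
      using that(1) by (auto simp: shifted_index_def group_like_one)
    ultimately show ?thesis
      using fam[of "Pair 1 ` A" "\<lambda>p. a (snd p)" "(1, w)"] \<open>finite A\<close> that(3) by simp
  qed
  show inj: "inj_on (\<lambda>w. prod_list (map Y w)) {w. length w = n}"
  proof (rule inj_onI)
    fix v w assume vw: "v \<in> {w. length w = n}" "w \<in> {w. length w = n}"
      "prod_list (map Y v) = prod_list (map Y w)"
    show "v = w"
    proof (rule ccontr)
      assume "v \<noteq> w"
      then have "(\<Sum>u\<in>{v, w}. scale (if u = v then 1 else - 1) (word u)) = 0"
        using vw(3) by (simp add: word_def)
      from coeff[OF _ this, of v] vw show False by simp
    qed
  qed
  show "independent ((\<lambda>w. prod_list (map Y w)) ` {w. length w = n})"
  proof (rule independent_if_scalars_zero)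
    show "finite ((\<lambda>w. prod_list (map Y w)) ` {w. length w = n})"
      by (intro finite_imageI finite_words)
    fix f x
    assume "(\<Sum>x\<in>(\<lambda>w. prod_list (map Y w)) ` {w. length w = n}. scale (f x) x) = 0"
      and x: "x \<in> (\<lambda>w. prod_list (map Y w)) ` {w. length w = n}"
    then have "(\<Sum>w | length w = n. scale (f (word w)) (word w)) = 0"
      by (simp add: sum.reindex[OF inj] word_def)
    from coeff[OF _ this] x show "f x = 0" by (auto simp: word_def)
  qed
qed

end

theorem proposition0p5:
  fixes scale :: "'k::{alg_closed_field, field_char_0} \<Rightarrow> 'h::ring_1 \<Rightarrow> 'h"
    and \<Delta> :: "'h \<Rightarrow> ('h \<times> 'h \<Rightarrow>\<^sub>0 'k) set"
    and \<epsilon> :: "'h \<Rightarrow> 'k"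
    and S :: "'h \<Rightarrow> 'h"
  assumes "hopf_algebra scale \<Delta> \<epsilon> S"
    and "comm_group (weight_group scale \<Delta>)"
    and "torsionfree (weight_group scale \<Delta>)"
    and "torsionfree_rank (commutator_group scale \<Delta>) > torsionfree_rank (weight_group scale \<Delta>)"
    and "torsionfree_rank (weight_group scale \<Delta>) = 1"
  shows "exponential_growth scale"
proof -
  interpret hopf_algebra scale \<Delta> \<epsilon> S by fact
  interpret GG: group "group_like_group scale \<Delta>" by (rule group_group_like)
  let ?WG = "weight_group scale \<Delta>" and ?C = "commutators scale \<Delta>"
  have "0 \<notin> ?C" by (auto simp: commutators_def is_commutator_def)
  with assms(4,5) obtain c1 c2 where c: "c1 \<in> ?C" "c2 \<in> ?C"
    and indep: "\<And>i j. c1 powi i * c2 powi j = 1 \<Longrightarrow> i = 0 \<and> j = 0"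
    unfolding commutator_group_def by (metis independent_generators)
  have "c1 \<noteq> 1" using indep[of 1 0] by auto
  have "c2 \<noteq> 1" using indep[of 0 1] by auto
  have "c1 \<noteq> 0" "c2 \<noteq> 0" using c \<open>0 \<notin> ?C\<close> by auto
  have "c1 \<noteq> c2" using indep[of 1 "-1"] \<open>c2 \<noteq> 0\<close> by (auto simp: power_int_minus)
  have data: "\<exists>y g. primitive_of_weight g y \<and> y \<notin> C0 \<and> g \<in> GL \<and> g \<in> carrier ?WG \<and> g \<noteq> 1
      \<and> S g * y * g - scale c y \<in> C0" if "c \<in> ?C" "c \<noteq> 1" for c
  proof -
    obtain y where y: "y \<in> nontrivial_skew_primitives scale \<Delta>" "is_commutator scale \<Delta> y c"
      using \<open>c \<in> ?C\<close> by (auto simp: commutators_def)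
    then obtain g where g: "primitive_of_weight g y" "y \<noteq> 0" "y \<notin> C0"
      by (auto simp: nontrivial_skew_primitives_def skew_primitive_def has_weight_iff)
    have GL: "g \<in> GL" by (rule weight_group_like[OF g(1,3)])
    have w: "weight scale \<Delta> y = g" by (rule weight_eq[OF g(2,1)])
    then have "g \<in> weights scale \<Delta>" using y(1) by (auto simp: weights_def)
    then have "g \<in> carrier ?WG"
      using GL unfolding weight_group_def carrier_subgroup_generated
      by (intro generate.incl) (simp add: group_like_group_def)
    moreover have comm: "S g * y * g - scale c y \<in> C0"
      using y(2) by (simp add: is_commutator_def w inv_group_like[OF GL])
    moreover have "g \<noteq> 1"
    proof
      assume "g = 1"
      then have "scale (1 - c) y \<in> C0"
        using comm group_like_inverse(2)[OF GL] by (simp add: scale_left_diff_distrib)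
      then have "scale (inverse (1 - c)) (scale (1 - c) y) \<in> C0"
        by (rule subspace_scale[OF group_like_span_subspace])
      then show False using g(3) \<open>c \<noteq> 1\<close> by simp
    qed
    ultimately show ?thesis using g GL by blast
  qed
  obtain y1 g1 where y1: "primitive_of_weight g1 y1" "y1 \<notin> C0" "g1 \<in> GL" "g1 \<in> carrier ?WG" "g1 \<noteq> 1"
      "S g1 * y1 * g1 - scale c1 y1 \<in> C0"
    using data[OF c(1) \<open>c1 \<noteq> 1\<close>] by blast
  obtain y2 g2 where y2: "primitive_of_weight g2 y2" "y2 \<notin> C0" "g2 \<in> GL" "g2 \<in> carrier ?WG" "g2 \<noteq> 1"
      "S g2 * y2 * g2 - scale c2 y2 \<in> C0"
    using data[OF c(2) \<open>c2 \<noteq> 1\<close>] by blast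
  have one: "\<one>\<^bsub>?WG\<^esub> = 1" and mult: "x \<otimes>\<^bsub>?WG\<^esub> x' = x * x'" for x x'
    by (simp_all add: weight_group_def group_like_group_def)
  have comm: "g1 * g2 = g2 * g1"
    using comm_monoid.m_comm[OF comm_group.axioms(1)[OF assms(2)] y1(4) y2(4)] by (simp add: mult)
  obtain i j :: int where ij: "i \<noteq> 0" "j \<noteq> 0" "g1 [^]\<^bsub>?WG\<^esub> i = g2 [^]\<^bsub>?WG\<^esub> j"
    using rank_one_commensurable[OF assms(2,3,5) y1(4) _ y2(4)] y1(5) y2(5) by (auto simp: one)
  then have pow: "g1 [^]\<^bsub>GG\<^esub> i = g2 [^]\<^bsub>GG\<^esub> j"
    using y1(4) y2(4) by (simp add: weight_group_def GG.int_pow_subgroup_generated)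
  obtain v1 \<mu>1 where v1: "primitive_of_weight g1 v1" "v1 \<notin> C0" "v1 * g1 = scale c1 (g1 * v1)"
    "v1 * g2 = scale \<mu>1 (g2 * v1)" "\<mu>1 powi j = c1 powi i"
    using common_eigenvector[OF assms(1) y1(3) y2(3) comm ij(2) pow y1(1,2,6) \<open>c1 \<noteq> 0\<close> \<open>c1 \<noteq> 1\<close>] .
  obtain v2 \<mu>2 where v2: "primitive_of_weight g2 v2" "v2 \<notin> C0" "v2 * g2 = scale c2 (g2 * v2)"
    "v2 * g1 = scale \<mu>2 (g1 * v2)" "\<mu>2 powi i = c2 powi j"
    using common_eigenvector[OF assms(1) y2(3) y1(3) comm[symmetric] ij(1) pow[symmetric] y2(1,2,6)
        \<open>c2 \<noteq> 0\<close> \<open>c2 \<noteq> 1\<close>] .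
  define Y where "Y b = (if b then v2 else v1)" for b
  define G where "G b = (if b then g2 else g1)" for b
  define q where "q x m = (if x then if m then c2 else \<mu>2 else if m then \<mu>1 else c1)" for x m
  interpret braided_letters scale \<Delta> \<epsilon> S Y G q
  proof
    fix a x assume "(\<Sum>x\<in>UNIV. scale (a x) (Y x)) \<in> C0"
    then have "scale (a False) v1 + scale (a True) v2 \<in> C0"
      by (simp add: UNIV_bool Y_def)
    from two_eigenvectors_independent[OF y1(3) y2(3) v1(1-3) v2(1-3) \<open>c1 \<noteq> c2\<close> this]
    show "a x = 0" by (cases x) auto
  next
    fix w :: "bool list" assume "2 \<le> length w"
    then show "full_twist q w \<noteq> 1"
      using full_twist_nonresonant[of q i j w] indep ij \<open>c1 \<noteq> 0\<close> \<open>c2 \<noteq> 0\<close> v1(5) v2(5)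
      by (simp add: q_def)
  qed (use v1 v2 y1 y2 in \<open>auto simp: Y_def G_def q_def\<close>)
  show ?thesis by (rule exponential_growth_if_two_letters) simp
qed

end
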